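(* Let $N\ge 1$ be an integer and let $a,b\in\mathbb R$. Let $H_N$ be the restriction of the one-dimensional nearest-neighbour Heisenberg Hamiltonian (with anisotropy parameters $a,b$) to the subspace $\ell^2[\mathbb F_N(\mathbb Z)]$ of configurations with exactly $N$ spins pointing up, as defined in the context. Then $H_N$ is unitarily equivalent to the operator $T^<_\varphi+V^<_\psi$ acting in $\ell^2(\mathbb Z^N_<)$, where $\varphi:=-2a\chi_S$ and $\psi:=2b\chi_S$.
   Context: All Hilbert spaces are complex, and $\chi_A$ denotes the characteristic function of a set $A$. Heisenberg Hamiltonian. Let $\mathbb F(\mathbb Z)$ be the set of functions $\alpha:\mathbb Z\to\{0,1\}$ with finite support, and let $\mathbb F_N(\mathbb Z)$ be the subset of those $\alpha$ whose support has exactly $N$ elements. Let $e^0:=(0,1)$ and $e^1:=(1,0)$ in $\mathbb C^2$. Let $\mathcal L$ be the incomplete tensor product of copies $\mathbb C^2_x$ of $\mathbb C^2$, $x\in\mathbb Z$, with reference vector $\bigotimes_{x}e^0$, i.e. the Hilbert space with orthonormal basis $\{e^\alpha:\alpha\in\mathbb F(\mathbb Z)\}$, $e^\alpha=\{e^{\alpha(x)}\}_{x\in\mathbb Z}$. For $x\in\mathbb Z$ and $j\in\{1,2,3\}$ the operator $\sigma^{(x)}_j$ acts in $\mathcal L$ as the Pauli matrix $\sigma_j$ on the factor at $x$ and as the identity on every other factor; here $\sigma_1e^0=e^1$, $\sigma_1e^1=e^0$, $\sigma_2e^1=ie^0$, $\sigma_2e^0=-ie^1$, $\sigma_3e^1=e^1$,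 $\sigma_3e^0=-e^0$. The Heisenberg Hamiltonian is $$L:=-\frac12\sum_{|x-y|=1}\Big\{a\big[\sigma_1^{(x)}\sigma_1^{(y)}+\sigma_2^{(x)}\sigma_2^{(y)}\big]+b\big[\sigma_3^{(x)}\sigma_3^{(y)}-1\big]\Big\},$$ the sum being over ordered pairs $(x,y)\in\mathbb Z^2$ with $|x-y|=1$ (applied to a basis vector $e^\alpha$, only finitely many terms are non-zero). Let $\varsigma:\mathcal L\to\ell^2[\mathbb F(\mathbb Z)]$ be the unitary operator with $\varsigma e^\alpha=\chi_{\{\alpha\}}$. The subspace $\ell^2[\mathbb F_N(\mathbb Z)]$ is invariant under $\varsigma L\varsigma^{-1}$, and $H_N:=(\varsigma L\varsigma^{-1})\upharpoonright\ell^2[\mathbb F_N(\mathbb Z)]$ is a bounded symmetric operator. Toeplitz operators. Let $\mathbb Z^N_<:=\{(x_1,\dots,x_N)\in\mathbb Z^N: x_1<x_2<\dots<x_N\}$. For $\eta\in\mathbb Z^N$ let $(u_\eta f)(\xi):=f(\xi-\eta)$ for $f\in\ell^2(\mathbb Z^N)$, let $P^<:\ell^2(\mathbb Z^N)\to\ell^2(\mathbb Z^N_<)$ be the projection given by multiplication by $\chi_{\mathbb Z^N_<}$, and set $v^<_\eta:=P^<u_\eta\upharpoonright\ell^2(\mathbb Z^N_<)$ (a partial isometry in $\ell^2(\mathbb Z^N_<)$) and $q^<_\eta:=v^<_\eta(v^<_\eta)^*$. For $\varphi\in\ell^1(\mathbb Z^N)$ put $$T^<_\varphi:=\sum_{\eta\in\mathbb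 Z^N}\varphi(\eta)v^<_\eta,\qquad V^<_\varphi:=\sum_{\eta\in\mathbb Z^N}\varphi(\eta)q^<_\eta .$$ The set $S\subset\mathbb Z^N$ is $S:=\{s^+_i,s^-_i: i=1,\dots,N\}$, where $s^\pm_i$ has components $(s^\pm_i)_j:=\pm\delta_{ij}$. *)

theory Defs
  imports "HOL-Analysis.Analysis" "HOL-Library.Function_Algebras"
begin

section \<open>Complex square-summable functions\<close>

lemma square_summable_mult:
  fixes f g :: "'a \<Rightarrow> complex"
  assumes "(\<lambda>x. (cmod (f x))\<^sup>2) summable_on A" "(\<lambda>x. (cmod (g x))\<^sup>2) summable_on A"
  shows "(\<lambda>x. f x * g x) summable_on A"
proof -
  have "(\<lambda>x. norm (f x * g x)) summable_on A"
  proof (rule Infinite_Sum.abs_summable_on_comparison_test')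
    show "(\<lambda>x. (cmod (f x))\<^sup>2 + (cmod (g x))\<^sup>2) summable_on A"
      using assms by (rule summable_on_add)
  next
    fix x
    have "2 * (cmod (f x) * cmod (g x)) \<le> (cmod (f x))\<^sup>2 + (cmod (g x))\<^sup>2"
      using sum_squares_bound[of "cmod (f x)" "cmod (g x)"] by simp
    moreover have "0 \<le> cmod (f x) * cmod (g x)" by simp
    ultimately show "norm (f x * g x) \<le> (cmod (f x))\<^sup>2 + (cmod (g x))\<^sup>2"
      unfolding norm_mult by linarith
  qed
  then show ?thesis by (rule abs_summable_summable)
qed

lemma square_summable_add:
  fixes f g :: "'a \<Rightarrow> complex"
  assumes "(\<lambda>x. (cmod (f x))\<^sup>2) summable_on A" "(\<lambda>x. (cmod (g x))\<^sup>2) summable_on A"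
  shows "(\<lambda>x. (cmod (f x + g x))\<^sup>2) summable_on A"
proof (rule summable_on_comparison_test)
  show "(\<lambda>x. 2 * (cmod (f x))\<^sup>2 + 2 * (cmod (g x))\<^sup>2) summable_on A"
    using assms by (intro summable_on_add summable_on_cmult_right)
next
  fix x
  have "(cmod (f x + g x))\<^sup>2 \<le> (cmod (f x) + cmod (g x))\<^sup>2"
    by (simp add: norm_triangle_ineq power_mono)
  also have "\<dots> \<le> 2 * (cmod (f x))\<^sup>2 + 2 * (cmod (g x))\<^sup>2"
    using sum_squares_bound[of "cmod (f x)" "cmod (g x)"] by (simp add: power2_sum)
  finally show "(cmod (f x + g x))\<^sup>2 \<le> 2 * (cmod (f x))\<^sup>2 + 2 * (cmod (g x))\<^sup>2" .
qed simp

lemma square_summable_cmult: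
  fixes f :: "'a \<Rightarrow> complex"
  assumes "(\<lambda>x. (cmod (f x))\<^sup>2) summable_on A"
  shows "(\<lambda>x. (cmod (c * f x))\<^sup>2) summable_on A"
  using summable_on_cmult_right[OF assms, of "(cmod c)\<^sup>2"]
  by (simp add: norm_mult power_mult_distrib)

lemma square_summable_finite_support:
  fixes f :: "'a \<Rightarrow> complex"
  assumes "finite F" "\<And>x. x \<notin> F \<Longrightarrow> f x = 0"
  shows "(\<lambda>x. (cmod (f x))\<^sup>2) summable_on A"
  by (rule summable_on_cong_neutral[THEN iffD1, OF _ _ _ summable_on_finite[of "F \<inter> A"]])
    (use assms in auto)

typedef 'a ell2 = "{f :: 'a \<Rightarrow> complex. (\<lambda>x. (cmod (f x))\<^sup>2) summable_on UNIV}"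
  morphisms ell2_apply Abs_ell2
  by (rule exI[of _ "\<lambda>_. 0"]) simp

setup_lifting type_definition_ell2

lift_definition cinner :: "'a ell2 \<Rightarrow> 'a ell2 \<Rightarrow> complex"
  is "\<lambda>f g. \<Sum>\<^sub>\<infinity>x. cnj (f x) * g x" .

lift_definition scaleC :: "complex \<Rightarrow> 'a ell2 \<Rightarrow> 'a ell2" (infixr \<open>*\<^sub>C\<close> 75)
  is "\<lambda>c f x. c * f x"
  by (rule square_summable_cmult)

instantiation ell2 :: (type) real_vector
begin

lift_definition zero_ell2 :: "'a ell2" is "\<lambda>_. 0" by simp

lift_definition plus_ell2 :: "'a ell2 \<Rightarrow> 'a ell2 \<Rightarrow> 'a ell2" is "\<lambda>f g x. f x + g x"
  by (rule square_summable_add)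

lift_definition uminus_ell2 :: "'a ell2 \<Rightarrow> 'a ell2" is "\<lambda>f x. - f x" by simp

lift_definition minus_ell2 :: "'a ell2 \<Rightarrow> 'a ell2 \<Rightarrow> 'a ell2" is "\<lambda>f g x. f x - g x"
  using square_summable_add[of _ UNIV "\<lambda>x. - _ x"] by simp

definition scaleR_ell2 :: "real \<Rightarrow> 'a ell2 \<Rightarrow> 'a ell2"
  where "scaleR_ell2 r f = complex_of_real r *\<^sub>C f"

instance
proof
  fix f g h :: "'a ell2" and r s :: real
  show "f + g + h = f + (g + h)" by transfer (simp add: add.assoc)
  show "f + g = g + f" by transfer (simp add: add.commute)
  show "0 + f = f" by transfer simp
  show "- f + f = 0" by transfer simp
  show "f - g = f + - g" by transfer simp
  show "r *\<^sub>R (f + g) = r *\<^sub>R f + r *\<^sub>R g"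
    unfolding scaleR_ell2_def by transfer (simp add: algebra_simps)
  show "(r + s) *\<^sub>R f = r *\<^sub>R f + s *\<^sub>R f"
    unfolding scaleR_ell2_def by transfer (simp add: algebra_simps)
  show "r *\<^sub>R s *\<^sub>R f = (r * s) *\<^sub>R f"
    unfolding scaleR_ell2_def by transfer (simp add: algebra_simps)
  show "1 *\<^sub>R f = f" unfolding scaleR_ell2_def by transfer simp
qed

end

lemma ell2_mult_summable:
  fixes f g :: "'a ell2"
  shows "(\<lambda>x. cnj (ell2_apply f x) * ell2_apply g x) summable_on UNIV"
  using ell2_apply[of f] ell2_apply[of g] by (intro square_summable_mult) auto

lemma cinner_self:
  fixes f :: "'a ell2"
  shows "cinner f f = complex_of_real (\<Sum>\<^sub>\<infinity>x. (cmod (ell2_apply f x))\<^sup>2)"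
proof -
  have "cinner f f = (\<Sum>\<^sub>\<infinity>x. complex_of_real ((cmod (ell2_apply f x))\<^sup>2))"
    unfolding cinner.rep_eq by (intro infsum_cong) (metis complex_norm_square mult.commute)
  also have "\<dots> = complex_of_real (\<Sum>\<^sub>\<infinity>x. (cmod (ell2_apply f x))\<^sup>2)"
    using ell2_apply[of f] by (intro infsumI has_sum_of_real_iff[THEN iffD2] has_sum_infsum) simp
  finally show ?thesis .
qed

instantiation ell2 :: (type) real_inner
begin

definition inner_ell2 :: "'a ell2 \<Rightarrow> 'a ell2 \<Rightarrow> real"
  where "inner_ell2 f g = Re (cinner f g)"

definition norm_ell2 :: "'a ell2 \<Rightarrow> real"
  where "norm_ell2 f = sqrt (inner f f)"

definition sgn_ell2 :: "'a ell2 \<Rightarrow> 'a ell2"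
  where "sgn_ell2 f = inverse (norm f) *\<^sub>R f"

definition dist_ell2 :: "'a ell2 \<Rightarrow> 'a ell2 \<Rightarrow> real"
  where "dist_ell2 f g = norm (f - g)"

definition uniformity_ell2 :: "('a ell2 \<times> 'a ell2) filter"
  where "uniformity_ell2 = (INF e\<in>{0<..}. principal {(f, g). dist f g < e})"

definition open_ell2 :: "'a ell2 set \<Rightarrow> bool"
  where "open_ell2 U \<longleftrightarrow> (\<forall>x\<in>U. \<forall>\<^sub>F (x', y) in uniformity. x' = x \<longrightarrow> y \<in> U)"

instance
proof
  fix f g h :: "'a ell2" and r :: real
  show "dist f g = norm (f - g)" by (rule dist_ell2_def)
  show "sgn f = f /\<^sub>R norm f" by (rule sgn_ell2_def)
  show "uniformity = (INF e\<in>{0<..}. principal {(x :: 'a ell2, y). dist x y < e})"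
    by (rule uniformity_ell2_def)
  show "open U \<longleftrightarrow> (\<forall>x\<in>U. \<forall>\<^sub>F (x', y) in uniformity. x' = x \<longrightarrow> y \<in> U)" for U :: "'a ell2 set"
    by (rule open_ell2_def)
  show "norm f = sqrt (inner f f)" by (rule norm_ell2_def)
  have "cinner g f = cnj (cinner f g)"
    unfolding cinner.rep_eq by (subst infsum_cnj[symmetric]) (simp add: mult.commute)
  then show "inner f g = inner g f" by (simp add: inner_ell2_def)
  have "cinner (f + g) h = cinner f h + cinner g h"
    unfolding cinner.rep_eq plus_ell2.rep_eq
    by (simp add: ring_distribs infsum_add ell2_mult_summable)
  then show "inner (f + g) h = inner f h + inner g h" by (simp add: inner_ell2_def)
  have "cinner (complex_of_real r *\<^sub>C f) g = complex_of_real r * cinner f g"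
    unfolding cinner.rep_eq scaleC.rep_eq
    by (simp add: mult.assoc infsum_cmult_right')
  then show "inner (r *\<^sub>R f) g = r * inner f g" by (simp add: inner_ell2_def scaleR_ell2_def)
  show "0 \<le> inner f f" by (simp add: inner_ell2_def cinner_self infsum_nonneg)
  show "inner f f = 0 \<longleftrightarrow> f = 0"
  proof
    assume "inner f f = 0"
    then have "(\<Sum>\<^sub>\<infinity>x. (cmod (ell2_apply f x))\<^sup>2) = 0" by (simp add: inner_ell2_def cinner_self)
    then have "(cmod (ell2_apply f x))\<^sup>2 = 0" for x
      by (rule nonneg_infsum_le_0D[OF eq_refl]) (use ell2_apply[of f] in auto)
    then show "f = 0" by transfer (simp add: fun_eq_iff)
  qed (simp add: inner_ell2_def cinner_self zero_ell2.rep_eq)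
qed

end

global_interpretation cell2: vector_space "scaleC :: complex \<Rightarrow> 'a ell2 \<Rightarrow> 'a ell2"
  by standard (transfer; simp add: algebra_simps)+

text \<open>All Hilbert spaces below are closed subspaces of some \<^typ>\<open>'a ell2\<close>; an operator acting in
  such a subspace is a HOL function, whose values outside the subspace are irrelevant.
  The space of square-summable functions on a set \<open>X\<close> consists of those supported in \<open>X\<close>.\<close>

definition ell2_on :: "'a set \<Rightarrow> 'a ell2 set"
  where "ell2_on X = {f. \<forall>x. x \<notin> X \<longrightarrow> ell2_apply f x = 0}"

lift_definition ell2_unit :: "'a \<Rightarrow> 'a ell2" is "\<lambda>x. indicator {x}"
  by (rule square_summable_finite_support[of "{_}"]) (auto simp: indicator_def)

lift_definition ell2_restrict :: "'a set \<Rightarrow> 'a ell2 \<Rightarrow> 'a ell2" is "\<lambda>X f x. indicator X x * f x"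
  by (erule summable_on_comparison_test) (auto simp: indicator_def)

lift_definition ell2_shift :: "'a::ab_group_add \<Rightarrow> 'a ell2 \<Rightarrow> 'a ell2"
  is "\<lambda>\<eta> f \<xi>. f (\<xi> - \<eta>)"
proof -
  fix \<eta> :: 'a and f :: "'a \<Rightarrow> complex"
  assume "(\<lambda>x. (cmod (f x))\<^sup>2) summable_on UNIV"
  moreover have "bij_betw (\<lambda>\<xi>. \<xi> - \<eta>) UNIV UNIV"
    by (rule bij_betw_byWitness[of _ "\<lambda>\<xi>. \<xi> + \<eta>"]) auto
  ultimately show "(\<lambda>\<xi>. (cmod (f (\<xi> - \<eta>)))\<^sup>2) summable_on UNIV"
    using summable_on_reindex_bij_betw[of "\<lambda>\<xi>. \<xi> - \<eta>" UNIV UNIV "\<lambda>x. (cmod (f x))\<^sup>2"] by simp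
qed

definition unitary_on :: "'a ell2 set \<Rightarrow> 'b ell2 set \<Rightarrow> ('a ell2 \<Rightarrow> 'b ell2) \<Rightarrow> bool"
  where "unitary_on H K U \<longleftrightarrow>
    bij_betw U H K \<and>
    (\<forall>f\<in>H. \<forall>g\<in>H. U (f + g) = U f + U g) \<and>
    (\<forall>c. \<forall>f\<in>H. U (c *\<^sub>C f) = c *\<^sub>C U f) \<and>
    (\<forall>f\<in>H. \<forall>g\<in>H. cinner (U f) (U g) = cinner f g)"

definition unitarily_equivalent ::
    "'a ell2 set \<Rightarrow> ('a ell2 \<Rightarrow> 'a ell2) \<Rightarrow> 'b ell2 set \<Rightarrow> ('b ell2 \<Rightarrow> 'b ell2) \<Rightarrow> bool"
  where "unitarily_equivalent H A K B \<longleftrightarrow>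
    A \<in> H \<rightarrow> H \<and> B \<in> K \<rightarrow> K \<and> (\<exists>U. unitary_on H K U \<and> (\<forall>f\<in>H. U (A f) = B (U f)))"

text \<open>On \<open>H\<close> the adjoint is unique whenever it exists.\<close>

definition adjoint_on :: "'a ell2 set \<Rightarrow> ('a ell2 \<Rightarrow> 'a ell2) \<Rightarrow> 'a ell2 \<Rightarrow> 'a ell2"
  where "adjoint_on H A =
    (SOME B. B \<in> H \<rightarrow> H \<and> (\<forall>f\<in>H. \<forall>g\<in>H. cinner (A f) g = cinner f (B g)))"


section \<open>The Heisenberg Hamiltonian\<close>

definition configs :: "(int \<Rightarrow> nat) set"
  where "configs = {\<alpha>. range \<alpha> \<subseteq> {0, 1} \<and> finite {x. \<alpha> x \<noteq> 0}}"

definition configs_N :: "nat \<Rightarrow> (int \<Rightarrow> nat) set"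
  where "configs_N N = {\<alpha> \<in> configs. card {x. \<alpha> x \<noteq> 0} = N}"

definition spin :: "nat \<Rightarrow> complex^2"
  where "spin n = (if n = 0 then vector [0, 1] else vector [1, 0])"

definition vinner :: "complex^2 \<Rightarrow> complex^2 \<Rightarrow> complex"
  where "vinner v w = (\<Sum>i\<in>UNIV. cnj (v $ i) * w $ i)"

definition pauli1 :: "complex^2^2"
  where "pauli1 = vector [vector [0, 1], vector [1, 0]]"

definition pauli2 :: "complex^2^2"
  where "pauli2 = vector [vector [0, - \<i>], vector [\<i>, 0]]"

definition pauli3 :: "complex^2^2"
  where "pauli3 = vector [vector [1, 0], vector [0, -1]]"

lemma pauli_spin:
  "pauli1 *v spin 0 = spin 1" "pauli1 *v spin 1 = spin 0"
  "pauli2 *v spin 1 = \<i> *s spin 0" "pauli2 *v spin 0 = - \<i> *s spin 1"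
  "pauli3 *v spin 1 = spin 1" "pauli3 *v spin 0 = - spin 0"
  by (simp_all add: vec_eq_iff forall_2 matrix_vector_mult_def sum_2 spin_def
      pauli1_def pauli2_def pauli3_def)

text \<open>The incomplete tensor product of the \<open>\<complex>\<^sup>2\<close>, \<open>x \<in> \<int>\<close>, with reference vector \<open>\<Otimes>\<^sub>x spin 0\<close>,
  is realised inside the square-summable functions on \<^const>\<open>configs\<close>: the product vector
  \<open>\<Otimes>\<^sub>x f x\<close> of a family that differs from the reference family at finitely many sites is the
  function of its coordinates, and the tensor product is the closed linear span of all product
  vectors. Lemma \<open>cinner_product_vector\<close> below shows that the inner product of
  product vectors is the product of the inner products, which characterises the tensor product.\<close>

definition product_families :: "(int \<Rightarrow> complex^2) set"
  where "product_families = {f. finite {x. f x \<noteq> spin 0}}"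

text \<open>The coordinate is formally the product over all \<open>x \<in> \<int>\<close>; the omitted factors are 1.\<close>

definition product_coord :: "(int \<Rightarrow> complex^2) \<Rightarrow> (int \<Rightarrow> nat) \<Rightarrow> complex"
  where "product_coord f \<alpha> = (\<Prod>x | f x \<noteq> spin 0 \<or> \<alpha> x \<noteq> 0. vinner (spin (\<alpha> x)) (f x))"

lemma vinner_spin [simp]:
  "vinner (spin 0) (spin 0) = 1" "vinner (spin (Suc 0)) (spin (Suc 0)) = 1"
  "vinner (spin 0) (spin (Suc 0)) = 0" "vinner (spin (Suc 0)) (spin 0) = 0"
  by (simp_all add: vinner_def spin_def sum_2)

lemma configs_cases: "\<alpha> \<in> configs \<Longrightarrow> \<alpha> x = 0 \<or> \<alpha> x = Suc 0"
  unfolding configs_def by auto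

lemma product_coord_finite:
  assumes "\<alpha> \<in> configs" "finite A" "{x. f x \<noteq> spin 0} \<union> {x. \<alpha> x \<noteq> 0} \<subseteq> A"
  shows "product_coord f \<alpha> = (\<Prod>x\<in>A. vinner (spin (\<alpha> x)) (f x))"
  unfolding product_coord_def by (rule prod.mono_neutral_left) (use assms in auto)

lemma product_coord_outside:
  assumes "f \<in> product_families" "\<alpha> \<in> configs" "f x = spin 0" "\<alpha> x \<noteq> 0"
  shows "product_coord f \<alpha> = 0"
proof -
  have "vinner (spin (\<alpha> x)) (f x) = 0" using assms configs_cases[of \<alpha> x] by auto
  moreover have "finite ({x. f x \<noteq> spin 0} \<union> {x. \<alpha> x \<noteq> 0})"
    using assms by (simp add: product_families_def configs_def)
  ultimately show ?thesis
    unfolding product_coord_def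
    by (intro prod_zero bexI[of _ x]) (use assms in \<open>auto simp: Un_def\<close>)
qed

definition local_configs :: "int set \<Rightarrow> (int \<Rightarrow> nat) set"
  where "local_configs A = {\<alpha> \<in> configs. {x. \<alpha> x \<noteq> 0} \<subseteq> A}"

lemma bij_local_configs:
  assumes "finite A"
  shows "bij_betw (\<lambda>\<beta> x. if x \<in> A then \<beta> x else 0) (A \<rightarrow>\<^sub>E {0, 1}) (local_configs A)"
proof (rule bij_betw_byWitness[of _ "\<lambda>\<alpha>. restrict \<alpha> A"])
  show "\<forall>\<beta>\<in>A \<rightarrow>\<^sub>E {0, 1}. restrict (\<lambda>x. if x \<in> A then \<beta> x else 0) A = \<beta>"
    by (auto simp: fun_eq_iff PiE_iff extensional_def)
  show "\<forall>\<alpha>\<in>local_configs A. (\<lambda>x. if x \<in> A then restrict \<alpha> A x else 0) = \<alpha>"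
    by (auto simp: fun_eq_iff local_configs_def)
  show "(\<lambda>\<alpha>. restrict \<alpha> A) ` local_configs A \<subseteq> A \<rightarrow>\<^sub>E {0, 1}"
    using configs_cases by (force simp: local_configs_def)
  show "(\<lambda>\<beta> x. if x \<in> A then \<beta> x else 0) ` (A \<rightarrow>\<^sub>E {0, 1}) \<subseteq> local_configs A"
  proof safe
    fix \<beta> assume b: "\<beta> \<in> A \<rightarrow>\<^sub>E {0, 1::nat}"
    have "finite {x. (if x \<in> A then \<beta> x else 0) \<noteq> 0}"
      by (rule finite_subset[OF _ assms]) auto
    with b show "(\<lambda>x. if x \<in> A then \<beta> x else 0) \<in> local_configs A"
      unfolding local_configs_def configs_def by (force simp: PiE_iff)
  qed
qed

lemma finite_local_configs: "finite A \<Longrightarrow> finite (local_configs A)"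
  using bij_betw_finite[OF bij_local_configs] by (auto intro: finite_PiE)

lift_definition product_vector :: "(int \<Rightarrow> complex^2) \<Rightarrow> (int \<Rightarrow> nat) ell2"
  is "\<lambda>f \<alpha>. if f \<in> product_families \<and> \<alpha> \<in> configs then product_coord f \<alpha> else 0"
proof -
  fix f :: "int \<Rightarrow> complex^2"
  show "(\<lambda>\<alpha>. (cmod (if f \<in> product_families \<and> \<alpha> \<in> configs then product_coord f \<alpha> else 0))\<^sup>2)
    summable_on UNIV"
  proof (cases "f \<in> product_families")
    case True
    show ?thesis
    proof (rule square_summable_finite_support[of "local_configs {x. f x \<noteq> spin 0}"])
      show "finite (local_configs {x. f x \<noteq> spin 0})"
        using True by (simp add: finite_local_configs product_families_def)
    qed (use product_coord_outside in \<open>auto simp: local_configs_def\<close>)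
  qed simp
qed

lemma cinner_product_vector:
  assumes f: "f \<in> product_families" and g: "g \<in> product_families"
  shows "cinner (product_vector f) (product_vector g) =
    (\<Prod>x | f x \<noteq> spin 0 \<or> g x \<noteq> spin 0. vinner (f x) (g x))"
proof -
  define A where "A = {x. f x \<noteq> spin 0 \<or> g x \<noteq> spin 0}"
  have fin: "finite A"
    using f g by (auto simp: A_def product_families_def Collect_disj_eq simp del: disj_not1 intro: finite_subset[of _ "{x. f x \<noteq> spin 0} \<union> {x. g x \<noteq> spin 0}"])
  have parseval: "vinner v w = (\<Sum>b\<in>{0, 1}. cnj (vinner (spin b) v) * vinner (spin b) w)" for v w
    by (simp add: vinner_def spin_def sum_2)
  have "cinner (product_vector f) (product_vector g) =
      (\<Sum>\<^sub>\<infinity>\<alpha>\<in>local_configs A. cnj (product_coord f \<alpha>) * product_coord g \<alpha>)"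
    unfolding cinner.rep_eq
  proof (rule infsum_cong_neutral)
    fix \<alpha> assume \<alpha>: "\<alpha> \<in> UNIV - local_configs A"
    show "cnj (ell2_apply (product_vector f) \<alpha>) * ell2_apply (product_vector g) \<alpha> = 0"
    proof (cases "\<alpha> \<in> configs")
      case True
      then obtain x where "\<alpha> x \<noteq> 0" "x \<notin> A" using \<alpha> by (auto simp: local_configs_def)
      then have "product_coord f \<alpha> = 0"
        by (intro product_coord_outside[OF f True]) (auto simp: A_def)
      then show ?thesis by (simp add: product_vector.rep_eq)
    qed (simp add: product_vector.rep_eq)
  qed (use f g in \<open>auto simp: product_vector.rep_eq local_configs_def\<close>)
  also have "\<dots> = (\<Sum>\<alpha>\<in>local_configs A.
      \<Prod>x\<in>A. cnj (vinner (spin (\<alpha> x)) (f x)) * vinner (spin (\<alpha> x)) (g x))"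
  proof -
    have "product_coord h \<alpha> = (\<Prod>x\<in>A. vinner (spin (\<alpha> x)) (h x))"
      if "\<alpha> \<in> local_configs A" "h = f \<or> h = g" for h \<alpha>
      by (rule product_coord_finite) (use that fin in \<open>auto simp: local_configs_def A_def\<close>)
    then show ?thesis using fin by (simp add: finite_local_configs prod.distrib)
  qed
  also have "\<dots> = (\<Sum>\<beta>\<in>A \<rightarrow>\<^sub>E {0, 1}.
      \<Prod>x\<in>A. cnj (vinner (spin (\<beta> x)) (f x)) * vinner (spin (\<beta> x)) (g x))"
    by (subst sum.reindex_bij_betw[OF bij_local_configs[OF fin], symmetric])
      (auto intro!: sum.cong prod.cong)
  also have "\<dots> = (\<Prod>x\<in>A. \<Sum>b\<in>{0, 1}. cnj (vinner (spin b) (f x)) * vinner (spin b) (g x))"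
    by (rule prod_sum_PiE[symmetric]) (use fin in auto)
  finally show ?thesis by (simp only: parseval[symmetric] A_def)
qed

definition tensor_space :: "(int \<Rightarrow> nat) ell2 set"
  where "tensor_space = closure (cell2.span (product_vector ` product_families))"

definition config_vector :: "(int \<Rightarrow> nat) \<Rightarrow> (int \<Rightarrow> nat) ell2"
  where "config_vector \<alpha> = product_vector (\<lambda>x. spin (\<alpha> x))"

text \<open>The matrix \<open>M\<close> acting on the tensor factor at \<open>x\<close>, in coordinates;
  see \<open>site_op_product_vector\<close>.\<close>

lift_definition site_op :: "complex^2^2 \<Rightarrow> int \<Rightarrow> (int \<Rightarrow> nat) ell2 \<Rightarrow> (int \<Rightarrow> nat) ell2"
  is "\<lambda>M x \<psi> \<alpha>. if \<alpha> \<in> configs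
    then \<Sum>b\<in>{0, 1}. vinner (spin (\<alpha> x)) (M *v spin b) * \<psi> (\<alpha>(x := b)) else 0"
proof -
  fix M :: "complex^2^2" and x and \<psi> :: "(int \<Rightarrow> nat) \<Rightarrow> complex"
  assume \<psi>: "(\<lambda>\<alpha>. (cmod (\<psi> \<alpha>))\<^sup>2) summable_on UNIV"
  let ?C = "\<lambda>c. {\<alpha> \<in> configs. \<alpha> x = c}"
  have sm: "(\<lambda>\<alpha>. (cmod (\<Sum>b\<in>{0, 1}. vinner (spin (\<alpha> x)) (M *v spin b) * \<psi> (\<alpha>(x := b))))\<^sup>2)
      summable_on ?C c" for c
  proof -
    have one: "(\<lambda>\<alpha>. (cmod (\<psi> (\<alpha>(x := b))))\<^sup>2) summable_on ?C c" for b
    proof -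
      have "inj_on (\<lambda>\<alpha>. \<alpha>(x := b)) (?C c)"
        by (rule inj_onI) (metis (mono_tags, lifting) fun_upd_triv fun_upd_upd mem_Collect_eq)
      moreover have "(\<lambda>\<alpha>. (cmod (\<psi> \<alpha>))\<^sup>2) summable_on (\<lambda>\<alpha>. \<alpha>(x := b)) ` ?C c"
        using \<psi> by (rule summable_on_subset_banach) simp
      ultimately show ?thesis by (simp add: summable_on_reindex o_def)
    qed
    have "(\<lambda>\<alpha>. (cmod (\<Sum>b\<in>{0, 1}. vinner (spin c) (M *v spin b) * \<psi> (\<alpha>(x := b))))\<^sup>2)
        summable_on ?C c"
      using square_summable_add[OF square_summable_cmult[OF one] square_summable_cmult[OF one]]
      by simp
    then show ?thesis by (rule summable_on_cong[THEN iffD1, rotated]) auto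
  qed
  have "configs = ?C 0 \<union> ?C (Suc 0)" using configs_cases[of _ x] by auto
  then have "(\<lambda>\<alpha>. (cmod (\<Sum>b\<in>{0, 1}. vinner (spin (\<alpha> x)) (M *v spin b) * \<psi> (\<alpha>(x := b))))\<^sup>2)
      summable_on configs"
    using summable_on_Un_disjoint[OF sm sm, of 0 "Suc 0"] by fastforce
  then show "(\<lambda>\<alpha>. (cmod (if \<alpha> \<in> configs
      then \<Sum>b\<in>{0, 1}. vinner (spin (\<alpha> x)) (M *v spin b) * \<psi> (\<alpha>(x := b)) else 0))\<^sup>2)
      summable_on UNIV"
    by (rule summable_on_cong_neutral[THEN iffD1, rotated -1]) auto
qed

lemma configs_update: "\<alpha> \<in> configs \<Longrightarrow> b \<in> {0, 1} \<Longrightarrow> \<alpha>(x := b) \<in> configs"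
proof -
  assume \<alpha>: "\<alpha> \<in> configs" and b: "b \<in> {0, 1}"
  have "finite {y. (\<alpha>(x := b)) y \<noteq> 0}"
    by (rule finite_subset[of _ "insert x {y. \<alpha> y \<noteq> 0}"]) (use \<alpha> in \<open>auto simp: configs_def\<close>)
  then show ?thesis using \<alpha> b by (auto simp: configs_def image_subset_iff)
qed

lemma product_families_update: "f \<in> product_families \<Longrightarrow> f(x := v) \<in> product_families"
  unfolding product_families_def mem_Collect_eq
  by (rule finite_subset[of _ "insert x {y. f y \<noteq> spin 0}"]) auto

lemma site_op_product_vector:
  assumes f: "f \<in> product_families"
  shows "site_op M x (product_vector f) = product_vector (f(x := M *v f x))"
proof -
  have expand: "vinner (spin c) (M *v v) =
      (\<Sum>b\<in>{0, 1}. vinner (spin c) (M *v spin b) * vinner (spin b) v)" for c v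
    by (simp add: vinner_def spin_def sum_2 matrix_vector_mult_def algebra_simps)
  have "ell2_apply (site_op M x (product_vector f)) \<alpha> =
      ell2_apply (product_vector (f(x := M *v f x))) \<alpha>" for \<alpha>
  proof (cases "\<alpha> \<in> configs")
    case True
    define A where "A = insert x ({y. f y \<noteq> spin 0} \<union> {y. \<alpha> y \<noteq> 0})"
    have A: "finite A" "x \<in> A"
      using f True by (auto simp: A_def product_families_def configs_def)
    let ?R = "\<Prod>y\<in>A - {x}. vinner (spin (\<alpha> y)) (f y)"
    have "product_coord f (\<alpha>(x := b)) = vinner (spin b) (f x) * ?R" if "b \<in> {0, 1}" for b
    proof -
      have "product_coord f (\<alpha>(x := b)) = (\<Prod>y\<in>A. vinner (spin ((\<alpha>(x := b)) y)) (f y))"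
        by (rule product_coord_finite) (use A configs_update[OF True that] in \<open>auto simp: A_def\<close>)
      also have "\<dots> = vinner (spin b) (f x) * ?R"
        unfolding prod.remove[OF A] by (auto intro!: arg_cong2[where f = "(*)"] prod.cong)
      finally show ?thesis .
    qed
    then have "ell2_apply (site_op M x (product_vector f)) \<alpha> =
        vinner (spin (\<alpha> x)) (M *v f x) * ?R"
      using True f configs_update[OF True, of 0 x] configs_update[OF True, of 1 x]
      by (subst expand) (simp add: site_op.rep_eq product_vector.rep_eq algebra_simps)
    also have "\<dots> = product_coord (f(x := M *v f x)) \<alpha>"
    proof -
      have "product_coord (f(x := M *v f x)) \<alpha> =
          (\<Prod>y\<in>A. vinner (spin (\<alpha> y)) ((f(x := M *v f x)) y))"
        by (rule product_coord_finite) (use A True in \<open>auto simp: A_def\<close>)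
      also have "\<dots> = vinner (spin (\<alpha> x)) (M *v f x) * ?R"
        unfolding prod.remove[OF A] by (auto intro!: arg_cong2[where f = "(*)"] prod.cong)
      finally show ?thesis by simp
    qed
    finally show ?thesis
      using True product_families_update[OF f] by (simp add: product_vector.rep_eq)
  qed (simp add: site_op.rep_eq product_vector.rep_eq)
  then show ?thesis by (simp add: ell2_apply_inject[symmetric] fun_eq_iff)
qed

text \<open>The sum is taken over ordered pairs and is unconditional in norm; it defines the
  (unbounded) operator at those vectors where it converges.\<close>

definition heisenberg :: "real \<Rightarrow> real \<Rightarrow> (int \<Rightarrow> nat) ell2 \<Rightarrow> (int \<Rightarrow> nat) ell2"
  where "heisenberg a b \<psi> = (- 1 / 2) *\<^sub>C (\<Sum>\<^sub>\<infinity>(x, y) \<in> {(x, y). \<bar>x - y\<bar> = 1}.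
    complex_of_real a *\<^sub>C (site_op pauli1 x (site_op pauli1 y \<psi>) + site_op pauli2 x (site_op pauli2 y \<psi>)) +
    complex_of_real b *\<^sub>C (site_op pauli3 x (site_op pauli3 y \<psi>) - \<psi>))"

text \<open>The two requirements determine the unitary on \<^const>\<open>tensor_space\<close>.\<close>

definition varsigma :: "(int \<Rightarrow> nat) ell2 \<Rightarrow> (int \<Rightarrow> nat) ell2"
  where "varsigma = (SOME U. unitary_on tensor_space (ell2_on configs) U \<and>
    (\<forall>\<alpha>\<in>configs. U (config_vector \<alpha>) = ell2_unit \<alpha>))"

definition heisenberg_N :: "nat \<Rightarrow> real \<Rightarrow> real \<Rightarrow> (int \<Rightarrow> nat) ell2 \<Rightarrow> (int \<Rightarrow> nat) ell2"
  where "heisenberg_N N a b =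
    restrict (\<lambda>f. varsigma (heisenberg a b (inv_into tensor_space varsigma f)))
      (ell2_on (configs_N N))"


section \<open>Toeplitz operators\<close>

text \<open>Elements of \<open>\<int>\<^sup>N\<close> are functions on \<open>\<nat>\<close> that vanish outside \<open>{1..N}\<close>, so that addition
  and subtraction are the pointwise operations on functions.\<close>

definition ints_N :: "nat \<Rightarrow> (nat \<Rightarrow> int) set"
  where "ints_N N = {\<xi>. \<forall>i. i \<notin> {1..N} \<longrightarrow> \<xi> i = 0}"

definition ints_less :: "nat \<Rightarrow> (nat \<Rightarrow> int) set"
  where "ints_less N = {\<xi> \<in> ints_N N. strict_mono_on {1..N} \<xi>}"

definition v_less :: "nat \<Rightarrow> (nat \<Rightarrow> int) \<Rightarrow> (nat \<Rightarrow> int) ell2 \<Rightarrow> (nat \<Rightarrow> int) ell2"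
  where "v_less N \<eta> =
    restrict (\<lambda>f. ell2_restrict (ints_less N) (ell2_shift \<eta> f)) (ell2_on (ints_less N))"

definition q_less :: "nat \<Rightarrow> (nat \<Rightarrow> int) \<Rightarrow> (nat \<Rightarrow> int) ell2 \<Rightarrow> (nat \<Rightarrow> int) ell2"
  where "q_less N \<eta> f = v_less N \<eta> (adjoint_on (ell2_on (ints_less N)) (v_less N \<eta>) f)"

text \<open>For absolutely summable \<open>\<phi>\<close> the operator series below converge absolutely in operator
  norm, so their sums may be computed vectorwise.\<close>

definition T_less :: "nat \<Rightarrow> ((nat \<Rightarrow> int) \<Rightarrow> complex) \<Rightarrow> (nat \<Rightarrow> int) ell2 \<Rightarrow> (nat \<Rightarrow> int) ell2"
  where "T_less N \<phi> f = (\<Sum>\<^sub>\<infinity>\<eta>\<in>ints_N N. \<phi> \<eta> *\<^sub>C v_less N \<eta> f)"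

definition V_less :: "nat \<Rightarrow> ((nat \<Rightarrow> int) \<Rightarrow> complex) \<Rightarrow> (nat \<Rightarrow> int) ell2 \<Rightarrow> (nat \<Rightarrow> int) ell2"
  where "V_less N \<phi> f = (\<Sum>\<^sub>\<infinity>\<eta>\<in>ints_N N. \<phi> \<eta> *\<^sub>C q_less N \<eta> f)"

definition unit_step :: "nat \<Rightarrow> nat \<Rightarrow> int"
  where "unit_step i = (\<lambda>j. if j = i then 1 else 0)"

definition steps :: "nat \<Rightarrow> (nat \<Rightarrow> int) set"
  where "steps N = (\<Union>i\<in>{1..N}. {unit_step i, - unit_step i})"

end

theory Submission
  imports Defs
begin

text \<open>A configuration with \<open>N\<close> up-spins is the set of its occupied sites, and listing these sites in
  increasing order identifies it with a point of \<^term>\<open>ints_less N\<close>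
  (\<open>bij_betw_occupation\<close>). Pulling functions back along this bijection is the unitary of the
  theorem; what has to be compared is the action of the two operators on coordinates.

  On a pair of neighbouring sites with equal spins the Pauli products cancel: \<open>\<sigma>\<^sub>1\<sigma>\<^sub>1\<close> and
  \<open>\<sigma>\<^sub>2\<sigma>\<^sub>2\<close> have opposite signs there, and \<open>\<sigma>\<^sub>3\<sigma>\<^sub>3 - 1\<close> vanishes. On a pair with opposite
  spins the first two add up to twice the exchange of the spins, and the third gives \<open>-2\<close>
  (\<open>bond_term_apply\<close>). Each such bond occurs as two ordered pairs, which
  the factor \<open>-1/2\<close> in the Hamiltonian compensates. Hence the Hamiltonian sums, over all pairs
  of an occupied site and an empty neighbour, \<open>2b\<close> times the value at the configuration minus
  \<open>2a\<close> times the value after the particle has hopped (\<open>heisenberg_eqI\<close>).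

  On the Toeplitz side \<open>q_less N \<eta>\<close> is multiplication by the indicator of those \<open>\<xi>\<close> for which
  \<open>\<xi> - \<eta>\<close> is still strictly increasing. For a unit step \<open>\<eta>\<close> this says precisely that the site to
  which the particle would move is empty, so the admissible steps at \<open>\<xi>\<close> correspond to the hops
  of the configuration (\<open>sum_allowed_steps\<close>), and the two coordinate formulas agree term by term.

  The analytic point is that the sum over all pairs of neighbours converges in norm, although
  the operators in it do not become small. A configuration with \<open>N\<close> particles has at most
  \<open>4N\<close> ordered pairs of unlike neighbours; thus the summands overlap boundedly and their
  squared norms have a finite sum, and for such families in \<open>\<ell>\<^sup>2\<close> the pointwise sum is also the
  sum in norm (\<open>has_sum_bounded_overlap\<close>).\<close>

section \<open>Square-summable functions\<close>

lemma ell2_eqI: "(\<And>x. ell2_apply f x = ell2_apply g x) \<Longrightarrow> f = g"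
  by (simp add: ell2_apply_inject[symmetric] fun_eq_iff)

lemma ell2_apply_sum: "ell2_apply (sum g F) x = (\<Sum>i\<in>F. ell2_apply (g i) x)"
  by (induction F rule: infinite_finite_induct) (simp_all add: zero_ell2.rep_eq plus_ell2.rep_eq)

lemma ell2_norm_summable: "(\<lambda>x. (cmod (ell2_apply f x))\<^sup>2) summable_on UNIV"
  using ell2_apply[of f] by simp

lemma norm_ell2_square: "(norm f)\<^sup>2 = (\<Sum>\<^sub>\<infinity>x. (cmod (ell2_apply f x))\<^sup>2)"
  by (simp add: norm_ell2_def inner_ell2_def cinner_self infsum_nonneg)

lemma norm_scaleC: "norm (c *\<^sub>C f) = cmod c * norm f"
proof -
  have "(norm (c *\<^sub>C f))\<^sup>2 = (cmod c * norm f)\<^sup>2"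
    by (simp add: norm_ell2_square scaleC.rep_eq norm_mult power_mult_distrib infsum_cmult_right')
  then show ?thesis by (simp add: power2_eq_imp_eq)
qed

lemma cinner_unit_left: "cinner (ell2_unit x) f = ell2_apply f x"
proof -
  have "cinner (ell2_unit x) f = (\<Sum>\<^sub>\<infinity>y\<in>{x}. ell2_apply f y)"
    unfolding cinner.rep_eq ell2_unit.rep_eq by (rule infsum_cong_neutral) (auto simp: indicator_def)
  then show ?thesis by simp
qed

lemma ell2_unit_in: "x \<in> X \<Longrightarrow> ell2_unit x \<in> ell2_on X"
  by (auto simp: ell2_on_def ell2_unit.rep_eq indicator_def)

lemma ell2_on_apply: "f \<in> ell2_on X \<Longrightarrow> x \<notin> X \<Longrightarrow> ell2_apply f x = 0"
  by (simp add: ell2_on_def)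

lemma ell2_on_mono: "X \<subseteq> Y \<Longrightarrow> ell2_on X \<subseteq> ell2_on Y"
  by (auto simp: ell2_on_def)

lemma ell2_on_add: "f \<in> ell2_on X \<Longrightarrow> g \<in> ell2_on X \<Longrightarrow> f + g \<in> ell2_on X"
  by (simp add: ell2_on_def plus_ell2.rep_eq)

lemma ell2_on_scaleC: "f \<in> ell2_on X \<Longrightarrow> c *\<^sub>C f \<in> ell2_on X"
  by (simp add: ell2_on_def scaleC.rep_eq)

lemma ell2_on_sum: "(\<And>i. i \<in> F \<Longrightarrow> g i \<in> ell2_on X) \<Longrightarrow> sum g F \<in> ell2_on X"
  by (auto simp: ell2_on_def ell2_apply_sum)

lemma cmod_le_norm_ell2: "cmod (ell2_apply f x) \<le> norm f"
proof -
  have "(cmod (ell2_apply f x))\<^sup>2 \<le> (norm f)\<^sup>2"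
    using finite_sum_le_infsum[OF ell2_norm_summable[of f], of "{x}"] by (simp add: norm_ell2_square)
  then show ?thesis by (rule power2_le_imp_le) simp
qed

text \<open>Evaluation at a point is bounded by the norm, so vanishing at a point survives norm limits.\<close>

lemma closed_ell2_on: "closed (ell2_on X)"
proof -
  have "f \<in> ell2_on X" if "\<forall>n. s n \<in> ell2_on X" "s \<longlonglongrightarrow> f" for s f
  proof -
    have "ell2_apply f x = 0" if "x \<notin> X" for x
    proof -
      have "cmod (ell2_apply f x) \<le> norm (f - s n)" for n
        using cmod_le_norm_ell2[of "f - s n" x] \<open>\<forall>n. s n \<in> ell2_on X\<close> \<open>x \<notin> X\<close>
        by (simp add: minus_ell2.rep_eq ell2_on_def)
      moreover have "(\<lambda>n. norm (f - s n)) \<longlonglongrightarrow> 0"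
        using tendsto_norm[OF tendsto_diff[OF tendsto_const[of f] \<open>s \<longlonglongrightarrow> f\<close>]] by simp
      ultimately have "cmod (ell2_apply f x) \<le> 0"
        by (intro LIMSEQ_le_const) auto
      then show ?thesis by simp
    qed
    then show ?thesis by (simp add: ell2_on_def)
  qed
  then show ?thesis unfolding closed_sequential_limits by blast
qed

lemma ell2_restrict_in: "ell2_restrict X f \<in> ell2_on X"
  by (auto simp: ell2_on_def ell2_restrict.rep_eq)

text \<open>If at most \<open>K\<close> members of the family are non-zero at any point, then by Cauchy-Schwarz the square
  of a pointwise sum over the indices outside \<open>F\<close> is at most \<open>K\<close> times the sum of the squares.
  Summing over the points and interchanging the sums bounds the squared distance of the
  partial sum over \<open>F\<close> from \<open>G\<close> by \<open>K\<close> times a tail of a convergent series.\<close>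

lemma has_sum_bounded_overlap:
  fixes g :: "'i \<Rightarrow> 'a ell2"
  assumes fin: "\<And>x. finite {i \<in> I. ell2_apply (g i) x \<noteq> 0}"
    and card: "\<And>x. card {i \<in> I. ell2_apply (g i) x \<noteq> 0} \<le> K"
    and sq: "(\<lambda>i. (norm (g i))\<^sup>2) summable_on I"
    and G: "\<And>x. ell2_apply G x = (\<Sum>i | i \<in> I \<and> ell2_apply (g i) x \<noteq> 0. ell2_apply (g i) x)"
  shows "(g has_sum G) I"
proof -
  define h where "h i x = (cmod (ell2_apply (g i) x))\<^sup>2" for i x
  have norm_g: "(norm (g i))\<^sup>2 = (\<Sum>\<^sub>\<infinity>x. h i x)" for i
    by (simp add: norm_ell2_square h_def)
  have tail: "(norm (sum g F - G))\<^sup>2 \<le> K * (\<Sum>\<^sub>\<infinity>i\<in>I - F. (norm (g i))\<^sup>2)"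
    if F: "finite F" "F \<subseteq> I" for F
  proof -
    have sqF: "(\<lambda>i. (norm (g i))\<^sup>2) summable_on (I - F)"
      using sq by (rule summable_on_subset_banach) auto
    have joint: "(\<lambda>(i, x). h i x) summable_on (I - F) \<times> UNIV"
      by (rule summable_on_SigmaI[OF _ sqF])
        (use ell2_norm_summable in \<open>auto simp: norm_g h_def intro!: has_sum_infsum\<close>)
    have "(\<lambda>(x, i). h i x) summable_on UNIV \<times> (I - F)"
      using joint by (subst summable_on_swap) (simp add: case_prod_unfold)
    then have outer: "(\<lambda>x. \<Sum>\<^sub>\<infinity>i\<in>I - F. h i x) summable_on UNIV"
      using summable_on_Sigma_banach[of "\<lambda>x i. h i x" UNIV "\<lambda>_. I - F"] by simp
    have pointwise: "(cmod (ell2_apply (sum g F - G) x))\<^sup>2 \<le> K * (\<Sum>\<^sub>\<infinity>i\<in>I - F. h i x)" for x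
    proof -
      let ?J = "{i \<in> I. ell2_apply (g i) x \<noteq> 0}"
      have "(\<Sum>i\<in>?J. ell2_apply (g i) x) =
          (\<Sum>i\<in>?J \<inter> F. ell2_apply (g i) x) + (\<Sum>i\<in>?J - F. ell2_apply (g i) x)"
        by (rule sum.Int_Diff[OF fin])
      also have "(\<Sum>i\<in>?J \<inter> F. ell2_apply (g i) x) = (\<Sum>i\<in>F. ell2_apply (g i) x)"
        by (rule sum.mono_neutral_left) (use F in auto)
      finally have eq: "ell2_apply (sum g F - G) x = - (\<Sum>i\<in>?J - F. ell2_apply (g i) x)"
        by (simp add: minus_ell2.rep_eq ell2_apply_sum G)
      have "(cmod (ell2_apply (sum g F - G) x))\<^sup>2 \<le> (\<Sum>i\<in>?J - F. cmod (ell2_apply (g i) x))\<^sup>2"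
        unfolding eq norm_minus_cancel by (intro power_mono norm_sum norm_ge_zero)
      also have "\<dots> \<le> (\<Sum>i\<in>?J - F. h i x) * card (?J - F)"
        unfolding h_def by (rule sum_squared_le_sum_of_squares)
      also have "\<dots> \<le> (\<Sum>i\<in>?J - F. h i x) * K"
      proof (rule mult_left_mono)
        have "card (?J - F) \<le> card ?J" by (rule card_mono[OF fin]) auto
        then show "real (card (?J - F)) \<le> real K" using card[of x] by simp
      qed (simp add: h_def sum_nonneg)
      also have "(\<Sum>i\<in>?J - F. h i x) = (\<Sum>\<^sub>\<infinity>i\<in>I - F. h i x)"
        by (subst infsum_finite[symmetric, OF finite_Diff[OF fin]], rule infsum_cong_neutral)
          (auto simp: h_def)
      finally show ?thesis by (simp add: mult.commute)
    qed
    have "(norm (sum g F - G))\<^sup>2 \<le> (\<Sum>\<^sub>\<infinity>x. K * (\<Sum>\<^sub>\<infinity>i\<in>I - F. h i x))"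
      unfolding norm_ell2_square
      by (rule infsum_mono[OF ell2_norm_summable summable_on_cmult_right[OF outer] pointwise])
    also have "\<dots> = K * (\<Sum>\<^sub>\<infinity>x. \<Sum>\<^sub>\<infinity>i\<in>I - F. h i x)"
      by (rule infsum_cmult_right')
    also have "(\<Sum>\<^sub>\<infinity>x. \<Sum>\<^sub>\<infinity>i\<in>I - F. h i x) = (\<Sum>\<^sub>\<infinity>i\<in>I - F. (norm (g i))\<^sup>2)"
      unfolding norm_g by (rule infsum_swap_banach[OF joint, symmetric])
    finally show ?thesis .
  qed
  let ?M = "\<Sum>\<^sub>\<infinity>i\<in>I. (norm (g i))\<^sup>2"
  have "((\<lambda>F. \<Sum>i\<in>F. (norm (g i))\<^sup>2) \<longlongrightarrow> ?M) (finite_subsets_at_top I)"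
    using has_sum_infsum[OF sq] by (simp add: has_sum_def)
  then have "((\<lambda>F. K * (?M - (\<Sum>i\<in>F. (norm (g i))\<^sup>2))) \<longlongrightarrow> K * (?M - ?M)) (finite_subsets_at_top I)"
    by (intro tendsto_intros)
  then have lim: "((\<lambda>F. K * (?M - (\<Sum>i\<in>F. (norm (g i))\<^sup>2))) \<longlongrightarrow> 0) (finite_subsets_at_top I)"
    by simp
  have "((\<lambda>F. (norm (sum g F - G))\<^sup>2) \<longlongrightarrow> 0) (finite_subsets_at_top I)"
  proof (rule tendsto_sandwich[OF _ _ tendsto_const lim])
    show "\<forall>\<^sub>F F in finite_subsets_at_top I.
        (norm (sum g F - G))\<^sup>2 \<le> K * (?M - (\<Sum>i\<in>F. (norm (g i))\<^sup>2))"
    proof (rule eventually_finite_subsets_at_top_weakI)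
      fix F assume F: "finite F" "F \<subseteq> I"
      have "(\<Sum>\<^sub>\<infinity>i\<in>I - F. (norm (g i))\<^sup>2) = ?M - (\<Sum>i\<in>F. (norm (g i))\<^sup>2)"
        using infsum_Diff[OF sq summable_on_finite[OF F(1)] F(2)] F by simp
      then show "(norm (sum g F - G))\<^sup>2 \<le> K * (?M - (\<Sum>i\<in>F. (norm (g i))\<^sup>2))"
        using tail[OF F] by simp
    qed
  qed simp
  from tendsto_real_sqrt[OF this] have "((\<lambda>F. norm (sum g F - G)) \<longlongrightarrow> 0) (finite_subsets_at_top I)"
    by simp
  then show ?thesis
    unfolding has_sum_def by (simp add: LIM_zero_iff tendsto_norm_zero_iff)
qed

lemma has_sum_sum:
  fixes f :: "'i \<Rightarrow> 'a \<Rightarrow> 'b::topological_comm_monoid_add"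
  assumes "\<And>i. i \<in> F \<Longrightarrow> (f i has_sum s i) A"
  shows "((\<lambda>x. \<Sum>i\<in>F. f i x) has_sum (\<Sum>i\<in>F. s i)) A"
  using assms by (induction F rule: infinite_finite_induct) (auto intro: has_sum_add)

text \<open>In the sum of these squared norms every \<open>x \<in> X\<close> is counted at most \<open>K\<close> times, so the partial
  sums are bounded by \<open>K\<close> times the squared norm of \<open>f\<close>.\<close>

lemma summable_norm_restrict:
  assumes f: "f \<in> ell2_on X"
    and fin: "\<And>x. x \<in> X \<Longrightarrow> finite {i \<in> I. x \<in> D i}"
    and card: "\<And>x. x \<in> X \<Longrightarrow> card {i \<in> I. x \<in> D i} \<le> K"
  shows "(\<lambda>i. (norm (ell2_restrict (D i) f))\<^sup>2) summable_on I"
proof (rule nonneg_bdd_above_summable_on)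
  show "bdd_above (sum (\<lambda>i. (norm (ell2_restrict (D i) f))\<^sup>2) ` {F. F \<subseteq> I \<and> finite F})"
  proof (rule bdd_aboveI2)
    fix F assume "F \<in> {F. F \<subseteq> I \<and> finite F}"
    then have F: "F \<subseteq> I" "finite F" by auto
    let ?h = "\<lambda>i x. (cmod (ell2_apply (ell2_restrict (D i) f) x))\<^sup>2"
    have split: "((\<lambda>x. \<Sum>i\<in>F. ?h i x) has_sum (\<Sum>i\<in>F. (norm (ell2_restrict (D i) f))\<^sup>2)) UNIV"
      unfolding norm_ell2_square by (intro has_sum_sum has_sum_infsum ell2_norm_summable)
    then have "(\<Sum>i\<in>F. (norm (ell2_restrict (D i) f))\<^sup>2) = (\<Sum>\<^sub>\<infinity>x. \<Sum>i\<in>F. ?h i x)"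
      by (rule infsumI[symmetric])
    also have "\<dots> \<le> (\<Sum>\<^sub>\<infinity>x. K * (cmod (ell2_apply f x))\<^sup>2)"
    proof (rule infsum_mono)
      show "(\<Sum>i\<in>F. ?h i x) \<le> K * (cmod (ell2_apply f x))\<^sup>2" for x
      proof (cases "x \<in> X")
        case True
        have "(\<Sum>i\<in>F. ?h i x) = (\<Sum>i | i \<in> F \<and> x \<in> D i. (cmod (ell2_apply f x))\<^sup>2)"
          by (rule sum.mono_neutral_cong_right)
            (use F in \<open>auto simp: ell2_restrict.rep_eq indicator_def\<close>)
        also have "\<dots> = card {i \<in> F. x \<in> D i} * (cmod (ell2_apply f x))\<^sup>2" by simp
        also have "\<dots> \<le> K * (cmod (ell2_apply f x))\<^sup>2"
        proof (rule mult_right_mono)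
          have "card {i \<in> F. x \<in> D i} \<le> card {i \<in> I. x \<in> D i}"
            by (rule card_mono[OF fin[OF True]]) (use F in auto)
          then show "real (card {i \<in> F. x \<in> D i}) \<le> real K" using card[OF True] by simp
        qed simp
        finally show ?thesis .
      qed (use f in \<open>simp add: ell2_restrict.rep_eq ell2_on_apply\<close>)
      show "(\<lambda>x. \<Sum>i\<in>F. ?h i x) summable_on UNIV"
        using split by (rule has_sum_imp_summable)
      show "(\<lambda>x. K * (cmod (ell2_apply f x))\<^sup>2) summable_on UNIV"
        by (intro summable_on_cmult_right ell2_norm_summable)
    qed
    finally show "(\<Sum>i\<in>F. (norm (ell2_restrict (D i) f))\<^sup>2) \<le> (\<Sum>\<^sub>\<infinity>x. K * (cmod (ell2_apply f x))\<^sup>2)" .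
  qed
qed simp

section \<open>Transport along a bijection\<close>

text \<open>The injectivity test makes the definition total: without it the result need not be square
  summable.\<close>

lift_definition ell2_pullback :: "'a set \<Rightarrow> ('a \<Rightarrow> 'b) \<Rightarrow> 'b ell2 \<Rightarrow> 'a ell2"
  is "\<lambda>X k f x. if inj_on k X \<and> x \<in> X then f (k x) else 0"
proof -
  fix X :: "'a set" and k :: "'a \<Rightarrow> 'b" and f :: "'b \<Rightarrow> complex"
  assume f: "(\<lambda>x. (cmod (f x))\<^sup>2) summable_on UNIV"
  show "(\<lambda>x. (cmod (if inj_on k X \<and> x \<in> X then f (k x) else 0))\<^sup>2) summable_on UNIV"
  proof (cases "inj_on k X")
    case True
    have "(\<lambda>x. (cmod (f x))\<^sup>2) summable_on k ` X"
      using f by (rule summable_on_subset_banach) simp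
    then have "(\<lambda>x. (cmod (f (k x)))\<^sup>2) summable_on X"
      by (simp add: summable_on_reindex[OF True] o_def)
    then show ?thesis
      by (rule summable_on_cong_neutral[THEN iffD1, rotated -1]) (use True in auto)
  qed simp
qed

lemma ell2_pullback_in: "ell2_pullback X k f \<in> ell2_on X"
  by (simp add: ell2_on_def ell2_pullback.rep_eq)

lemma ell2_pullback_inverse:
  assumes k: "bij_betw k X Y" and l: "\<And>x. x \<in> X \<Longrightarrow> l (k x) = x" and f: "f \<in> ell2_on X"
  shows "ell2_pullback X k (ell2_pullback Y l f) = f"
proof (rule ell2_eqI)
  have "inj_on l Y"
    using k l by (intro inj_onI) (metis bij_betw_imp_surj_on imageE)
  then show "ell2_apply (ell2_pullback X k (ell2_pullback Y l f)) x = ell2_apply f x" for x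
    using k l f by (auto simp: ell2_pullback.rep_eq bij_betw_def ell2_on_apply)
qed

lemma unitary_on_ell2_pullback:
  assumes k: "bij_betw k X Y"
  shows "unitary_on (ell2_on Y) (ell2_on X) (ell2_pullback X k)"
  unfolding unitary_on_def
proof (intro conjI ballI allI)
  have inj: "inj_on k X" using k by (rule bij_betw_imp_inj_on)
  have l: "bij_betw (inv_into X k) Y X" using k by (rule bij_betw_inv_into)
  show "bij_betw (ell2_pullback X k) (ell2_on Y) (ell2_on X)"
  proof (rule bij_betw_byWitness[of _ "ell2_pullback Y (inv_into X k)"])
    show "\<forall>f\<in>ell2_on Y. ell2_pullback Y (inv_into X k) (ell2_pullback X k f) = f"
      using ell2_pullback_inverse[OF l, of k] bij_betw_inv_into_right[OF k] by auto
    show "\<forall>f\<in>ell2_on X. ell2_pullback X k (ell2_pullback Y (inv_into X k) f) = f"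
      using ell2_pullback_inverse[OF k] bij_betw_inv_into_left[OF k] by auto
  qed (auto simp: ell2_pullback_in)
  show "ell2_pullback X k (f + g) = ell2_pullback X k f + ell2_pullback X k g" for f g
    by transfer auto
  show "ell2_pullback X k (c *\<^sub>C f) = c *\<^sub>C ell2_pullback X k f" for c f
    by transfer auto
  fix f g assume f: "f \<in> ell2_on Y"
  have "cinner (ell2_pullback X k f) (ell2_pullback X k g) =
      (\<Sum>\<^sub>\<infinity>x\<in>X. cnj (ell2_apply f (k x)) * ell2_apply g (k x))"
    unfolding cinner.rep_eq ell2_pullback.rep_eq by (rule infsum_cong_neutral) (use inj in auto)
  also have "\<dots> = (\<Sum>\<^sub>\<infinity>y\<in>Y. cnj (ell2_apply f y) * ell2_apply g y)"
    by (rule infsum_reindex_bij_betw[OF k])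
  also have "\<dots> = cinner f g"
    unfolding cinner.rep_eq by (rule infsum_cong_neutral) (use f in \<open>auto simp: ell2_on_apply\<close>)
  finally show "cinner (ell2_pullback X k f) (ell2_pullback X k g) = cinner f g" .
qed

lemma unitary_on_norm: "unitary_on H K U \<Longrightarrow> f \<in> H \<Longrightarrow> norm (U f) = norm f"
  by (simp add: unitary_on_def norm_ell2_def inner_ell2_def)

section \<open>The tensor product in coordinates\<close>

lemma spin_family:
  assumes "\<alpha> \<in> configs"
  shows "spin (\<alpha> x) = spin 0 \<longleftrightarrow> \<alpha> x = 0" "(\<lambda>x. spin (\<alpha> x)) \<in> product_families"
proof -
  have *: "spin (\<alpha> x) = spin 0 \<longleftrightarrow> \<alpha> x = 0" for x
    using configs_cases[OF assms, of x] vinner_spin by (metis zero_neq_one)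
  show "spin (\<alpha> x) = spin 0 \<longleftrightarrow> \<alpha> x = 0" by (rule *)
  show "(\<lambda>x. spin (\<alpha> x)) \<in> product_families"
    using assms by (simp add: product_families_def * configs_def)
qed

text \<open>A coordinate of a product of basis spins is a product of orthonormality relations, and one of
  these vanishes as soon as the two configurations differ at some site.\<close>

lemma config_vector_eq_unit:
  assumes \<alpha>: "\<alpha> \<in> configs"
  shows "config_vector \<alpha> = ell2_unit \<alpha>"
proof (rule ell2_eqI)
  fix \<beta>
  show "ell2_apply (config_vector \<alpha>) \<beta> = ell2_apply (ell2_unit \<alpha>) \<beta>"
  proof (cases "\<beta> \<in> configs")
    case True
    let ?A = "{x. \<alpha> x \<noteq> 0} \<union> {x. \<beta> x \<noteq> 0}"
    have fin: "finite ?A" using \<alpha> True by (simp add: configs_def)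
    have "product_coord (\<lambda>x. spin (\<alpha> x)) \<beta> = (\<Prod>x\<in>?A. vinner (spin (\<beta> x)) (spin (\<alpha> x)))"
      by (rule product_coord_finite[OF True fin]) (simp add: spin_family[OF \<alpha>])
    also have "\<dots> = indicator {\<alpha>} \<beta>"
    proof (cases "\<beta> = \<alpha>")
      case True
      have "vinner (spin (\<alpha> x)) (spin (\<alpha> x)) = 1" for x
        using configs_cases[OF \<alpha>, of x] by auto
      then show ?thesis by (simp add: True)
    next
      case False
      then obtain x where x: "\<beta> x \<noteq> \<alpha> x" by auto
      then have "vinner (spin (\<beta> x)) (spin (\<alpha> x)) = 0" and "x \<in> ?A"
        using configs_cases[OF \<alpha>, of x] configs_cases[OF True, of x] by auto
      then have "(\<Prod>x\<in>?A. vinner (spin (\<beta> x)) (spin (\<alpha> x))) = 0"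
        using fin by (intro prod_zero) blast+
      then show ?thesis using False by simp
    qed
    finally show ?thesis
      using True spin_family(2)[OF \<alpha>]
      by (simp add: config_vector_def product_vector.rep_eq ell2_unit.rep_eq)
  next
    case False
    then have "\<beta> \<noteq> \<alpha>" using \<alpha> by auto
    then show ?thesis
      using False by (simp add: config_vector_def product_vector.rep_eq ell2_unit.rep_eq)
  qed
qed

text \<open>The multiples of the unit vectors in this expansion have disjoint supports, which is the overlap
  bound \<open>1\<close>.\<close>

lemma has_sum_units:
  assumes f: "f \<in> ell2_on X"
  shows "((\<lambda>x. ell2_apply f x *\<^sub>C ell2_unit x) has_sum f) X"
proof (rule has_sum_bounded_overlap[where K = 1])
  let ?J = "\<lambda>y. {x \<in> X. ell2_apply (ell2_apply f x *\<^sub>C ell2_unit x) y \<noteq> 0}"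
  have J: "?J y \<subseteq> {y}" for y
    by (auto simp: scaleC.rep_eq ell2_unit.rep_eq indicator_def)
  show fin: "finite (?J y)" for y
    using J by (rule finite_subset) simp
  show "card (?J y) \<le> 1" for y
    using card_mono[OF _ J] by simp
  have "(norm (ell2_unit x :: 'a ell2))\<^sup>2 = 1" for x
    by (simp add: norm_ell2_def inner_ell2_def cinner_unit_left ell2_unit.rep_eq)
  then show "(\<lambda>x. (norm (ell2_apply f x *\<^sub>C ell2_unit x))\<^sup>2) summable_on X"
    using ell2_norm_summable[of f]
    by (simp add: norm_scaleC power_mult_distrib summable_on_subset_banach[of _ UNIV])
  show "ell2_apply f y = (\<Sum>x\<in>?J y. ell2_apply (ell2_apply f x *\<^sub>C ell2_unit x) y)" for y
  proof -
    have "ell2_apply f y = (\<Sum>x\<in>X \<inter> {y}. ell2_apply f x * indicator {x} y)"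
      using f by (cases "y \<in> X") (auto simp: ell2_on_def)
    also have "\<dots> = (\<Sum>x\<in>?J y. ell2_apply (ell2_apply f x *\<^sub>C ell2_unit x) y)"
      by (rule sum.mono_neutral_cong_right)
        (auto simp: scaleC.rep_eq ell2_unit.rep_eq indicator_def split: if_splits)
    finally show ?thesis .
  qed
qed

text \<open>Product vectors are supported on the configurations, and the unit vectors at configurations
  are product vectors whose combinations approximate every \<open>f\<close>.\<close>

lemma tensor_space_eq: "tensor_space = ell2_on configs"
proof
  have "cell2.span (product_vector ` product_families) \<subseteq> ell2_on configs"
  proof (rule cell2.span_minimal)
    show "product_vector ` product_families \<subseteq> ell2_on configs"
      by (auto simp: ell2_on_def product_vector.rep_eq)
    show "cell2.subspace (ell2_on configs)"
      unfolding cell2.subspace_def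
      by (simp add: ell2_on_add ell2_on_scaleC) (simp add: ell2_on_def zero_ell2.rep_eq)
  qed
  then show "tensor_space \<subseteq> ell2_on configs"
    unfolding tensor_space_def by (rule closure_minimal) (rule closed_ell2_on)
  show "ell2_on configs \<subseteq> tensor_space"
  proof
    fix f assume f: "f \<in> ell2_on configs"
    let ?S = "cell2.span (product_vector ` product_families)"
    have "\<forall>\<^sub>F F in finite_subsets_at_top configs.
        (\<Sum>\<alpha>\<in>F. ell2_apply f \<alpha> *\<^sub>C ell2_unit \<alpha>) \<in> closure ?S"
    proof (rule eventually_finite_subsets_at_top_weakI)
      fix F :: "(int \<Rightarrow> nat) set" assume F: "finite F" "F \<subseteq> configs"
      have "ell2_unit \<alpha> \<in> ?S" if "\<alpha> \<in> F" for \<alpha>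
      proof -
        have "ell2_unit \<alpha> = product_vector (\<lambda>x. spin (\<alpha> x))"
          using config_vector_eq_unit[of \<alpha>] that F(2) by (auto simp: config_vector_def)
        then show ?thesis
          using that F(2) spin_family(2) by (auto intro: cell2.span_base)
      qed
      then have "(\<Sum>\<alpha>\<in>F. ell2_apply f \<alpha> *\<^sub>C ell2_unit \<alpha>) \<in> ?S"
        by (intro cell2.span_sum cell2.span_scale)
      then show "(\<Sum>\<alpha>\<in>F. ell2_apply f \<alpha> *\<^sub>C ell2_unit \<alpha>) \<in> closure ?S"
        using closure_subset by blast
    qed
    then have "f \<in> closure ?S"
      using has_sum_units[OF f]
      by (intro Lim_in_closed_set[OF closed_closure]) (auto simp: has_sum_def)
    then show "f \<in> tensor_space" by (simp add: tensor_space_def)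
  qed
qed

text \<open>In these coordinates the basis vector of \<open>\<alpha>\<close> already is the unit vector at \<open>\<alpha>\<close>, so the
  identity satisfies the defining requirements. Any other solution preserves the inner products
  with the basis vectors, hence the coordinates.\<close>

lemma varsigma_eq:
  assumes f: "f \<in> ell2_on configs"
  shows "varsigma f = f"
proof -
  have "unitary_on tensor_space (ell2_on configs) varsigma \<and>
      (\<forall>\<alpha>\<in>configs. varsigma (config_vector \<alpha>) = ell2_unit \<alpha>)"
    unfolding varsigma_def
  proof (rule someI[of _ id])
    show "unitary_on tensor_space (ell2_on configs) id \<and>
        (\<forall>\<alpha>\<in>configs. id (config_vector \<alpha>) = ell2_unit \<alpha>)"
      by (simp add: unitary_on_def tensor_space_eq config_vector_eq_unit)
  qed
  then have U: "bij_betw varsigma (ell2_on configs) (ell2_on configs)"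
    "\<And>g. g \<in> ell2_on configs \<Longrightarrow> cinner (varsigma g) (varsigma f) = cinner g f"
    "\<And>\<alpha>. \<alpha> \<in> configs \<Longrightarrow> varsigma (ell2_unit \<alpha>) = ell2_unit \<alpha>"
    using f by (auto simp: unitary_on_def tensor_space_eq config_vector_eq_unit)
  show ?thesis
  proof (rule ell2_eqI)
    fix \<alpha>
    show "ell2_apply (varsigma f) \<alpha> = ell2_apply f \<alpha>"
    proof (cases "\<alpha> \<in> configs")
      case True
      then show ?thesis
        using U(2)[of "ell2_unit \<alpha>"] by (simp add: ell2_unit_in U(3) cinner_unit_left)
    next
      case False
      then show ?thesis
        using f bij_betwE[OF U(1)] by (simp add: ell2_on_def)
    qed
  qed
qed

section \<open>The Heisenberg Hamiltonian in coordinates\<close>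

definition bond_term :: "real \<Rightarrow> real \<Rightarrow> int \<Rightarrow> int \<Rightarrow> (int \<Rightarrow> nat) ell2 \<Rightarrow> (int \<Rightarrow> nat) ell2"
  where "bond_term a b x y f =
    complex_of_real a *\<^sub>C (site_op pauli1 x (site_op pauli1 y f) + site_op pauli2 x (site_op pauli2 y f)) +
    complex_of_real b *\<^sub>C (site_op pauli3 x (site_op pauli3 y f) - f)"

lemma comp_transpose: "\<alpha> \<circ> Transposition.transpose x y = \<alpha>(x := \<alpha> y, y := \<alpha> x)"
  by (auto simp: fun_eq_iff transpose_def)

text \<open>Exchanging two spins conserves the number of up-spins; this is why the subspace of \<open>N\<close>
  particles is invariant.\<close>

lemma configs_comp_transpose: "\<alpha> \<circ> Transposition.transpose x y \<in> configs_N N \<longleftrightarrow> \<alpha> \<in> configs_N N"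
proof -
  have *: "\<alpha> \<circ> Transposition.transpose x y \<in> configs_N N" if "\<alpha> \<in> configs_N N" for \<alpha>
  proof -
    have eq: "{z. (\<alpha> \<circ> Transposition.transpose x y) z \<noteq> 0} = Transposition.transpose x y ` {z. \<alpha> z \<noteq> 0}"
      by (auto simp: in_transpose_image_iff)
    have "card (Transposition.transpose x y ` {z. \<alpha> z \<noteq> 0}) = card {z. \<alpha> z \<noteq> 0}"
      by (intro card_image inj_on_transpose)
    moreover have "\<alpha> z \<in> {0, 1}" for z
      using that configs_cases[of \<alpha> z] by (auto simp: configs_N_def)
    then have "range (\<alpha> \<circ> Transposition.transpose x y) \<subseteq> {0, 1}"
      unfolding image_subset_iff o_apply by blast
    ultimately show ?thesis
      using that unfolding configs_N_def configs_def mem_Collect_eq eq by auto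
  qed
  show ?thesis
    using *[of \<alpha>] *[of "\<alpha> \<circ> Transposition.transpose x y"] by (auto simp: comp_assoc)
qed

lemma configs_N_subset: "configs_N N \<subseteq> configs"
  by (auto simp: configs_N_def)

lemma vinner_scale: "vinner v (c *s w) = c * vinner v w" "vinner v (- w) = - vinner v w"
  by (simp_all add: vinner_def sum_2 algebra_simps)

lemma bond_term_apply:
  assumes f: "f \<in> ell2_on (configs_N N)" and xy: "x \<noteq> y"
  shows "ell2_apply (bond_term a b x y f) \<alpha> =
    (if \<alpha> x \<noteq> \<alpha> y then 2 * complex_of_real a * ell2_apply f (\<alpha> \<circ> Transposition.transpose x y) - 2 * complex_of_real b * ell2_apply f \<alpha> else 0)"
proof (cases "\<alpha> \<in> configs")
  case True
  have up: "\<alpha>(x := 0) \<in> configs" "\<alpha>(x := Suc 0) \<in> configs"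
    using configs_update[OF True] by auto
  have two: "ell2_apply (site_op M x (site_op M y f)) \<alpha> =
      (\<Sum>b\<in>{0, Suc 0}. vinner (spin (\<alpha> x)) (M *v spin b) *
        (\<Sum>c\<in>{0, Suc 0}. vinner (spin (\<alpha> y)) (M *v spin c) * ell2_apply f (\<alpha>(x := b, y := c))))" for M
    using xy True up by (simp add: site_op.rep_eq)
  note eqs = bond_term_def plus_ell2.rep_eq minus_ell2.rep_eq scaleC.rep_eq two comp_transpose
    pauli_spin[unfolded One_nat_def] vinner_scale
  have same: "\<alpha>(x := \<alpha> x, y := \<alpha> y) = \<alpha>" by simp
  consider "\<alpha> x = 0" "\<alpha> y = 0" | "\<alpha> x = 0" "\<alpha> y = Suc 0"
    | "\<alpha> x = Suc 0" "\<alpha> y = 0" | "\<alpha> x = Suc 0" "\<alpha> y = Suc 0"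
    using configs_cases[OF True] by metis
  then show ?thesis
  proof cases
    case 1
    then show ?thesis using same by (simp add: eqs)
  next
    case 2
    then show ?thesis using same by (simp add: eqs algebra_simps)
  next
    case 3
    then show ?thesis using same by (simp add: eqs algebra_simps)
  next
    case 4
    then show ?thesis using same by (simp add: eqs)
  qed
next
  case False
  then have "\<alpha> \<notin> configs_N N" using configs_N_subset by auto
  then have "ell2_apply f \<alpha> = 0" "ell2_apply f (\<alpha> \<circ> Transposition.transpose x y) = 0"
    using f by (auto intro!: ell2_on_apply simp: configs_comp_transpose)
  then show ?thesis using False
    by (simp add: bond_term_def plus_ell2.rep_eq minus_ell2.rep_eq scaleC.rep_eq site_op.rep_eq)
qed

text \<open>The bond term sees only the part \<open>r\<close> of \<open>f\<close> on the configurations with unlike spins at \<open>x\<close>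
  and \<open>y\<close>: it is \<open>2a\<close> times the image of \<open>r\<close> under a unitary exchange, minus \<open>2b\<close> times \<open>r\<close>.\<close>

lemma norm_bond_term_le:
  assumes f: "f \<in> ell2_on (configs_N N)" and xy: "x \<noteq> y"
  shows "norm (bond_term a b x y f) \<le>
    (2 * \<bar>a\<bar> + 2 * \<bar>b\<bar>) * norm (ell2_restrict {\<alpha>. \<alpha> x \<noteq> \<alpha> y} f)"
proof -
  define r where "r = ell2_restrict {\<alpha>. \<alpha> x \<noteq> \<alpha> y} f"
  let ?k = "\<lambda>\<alpha>. \<alpha> \<circ> Transposition.transpose x y"
  have k: "bij_betw ?k (UNIV :: (int \<Rightarrow> nat) set) UNIV"
    by (rule bij_betw_byWitness[of _ ?k]) (auto simp: comp_assoc)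
  define s where "s = ell2_pullback UNIV ?k r"
  have "bond_term a b x y f = complex_of_real (2 * a) *\<^sub>C s - complex_of_real (2 * b) *\<^sub>C r"
    by (rule ell2_eqI)
      (use bij_betw_imp_inj_on[OF k] in \<open>simp add: bond_term_apply[OF f xy] minus_ell2.rep_eq
        scaleC.rep_eq s_def r_def ell2_pullback.rep_eq ell2_restrict.rep_eq\<close>)
  then have "norm (bond_term a b x y f) \<le> 2 * \<bar>a\<bar> * norm s + 2 * \<bar>b\<bar> * norm r"
    using norm_triangle_ineq4[of "complex_of_real (2 * a) *\<^sub>C s" "complex_of_real (2 * b) *\<^sub>C r"]
    by (simp add: norm_scaleC norm_mult)
  also have "norm s = norm r"
    unfolding s_def by (rule unitary_on_norm[OF unitary_on_ell2_pullback[OF k]])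
      (simp add: ell2_on_def)
  finally show ?thesis by (simp add: r_def algebra_simps)
qed

definition unlike_neighbours :: "(int \<Rightarrow> nat) \<Rightarrow> (int \<times> int) set"
  where "unlike_neighbours \<alpha> = {(x, y). \<bar>x - y\<bar> = 1 \<and> \<alpha> x \<noteq> \<alpha> y}"

definition free_neighbours :: "(int \<Rightarrow> nat) \<Rightarrow> (int \<times> int) set"
  where "free_neighbours \<alpha> = {(x, y). \<bar>x - y\<bar> = 1 \<and> \<alpha> x \<noteq> 0 \<and> \<alpha> y = 0}"

text \<open>One site of an unlike pair is among the \<open>N\<close> occupied ones; the other lies on one of its two
  sides, and the pair has two orders.\<close>

lemma unlike_neighbours_bound:
  assumes "\<alpha> \<in> configs_N N"
  shows "finite (unlike_neighbours \<alpha>)" "card (unlike_neighbours \<alpha>) \<le> 4 * N"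
proof -
  let ?P = "{x. \<alpha> x \<noteq> 0} \<times> {1, -1 :: int} \<times> (UNIV :: bool set)"
  let ?h = "\<lambda>(x, d, s). if s then (x, x + d) else (x + d, x)"
  have sub: "unlike_neighbours \<alpha> \<subseteq> ?h ` ?P"
  proof
    fix p assume "p \<in> unlike_neighbours \<alpha>"
    then obtain x y where p: "p = (x, y)" "\<bar>x - y\<bar> = 1" "\<alpha> x \<noteq> \<alpha> y"
      by (auto simp: unlike_neighbours_def)
    show "p \<in> ?h ` ?P"
    proof (cases "\<alpha> x = 0")
      case True
      then show ?thesis
        using p by (intro image_eqI[of _ _ "(y, x - y, False)"]) auto
    next
      case False
      then show ?thesis
        using p by (intro image_eqI[of _ _ "(x, y - x, True)"]) auto
    qed
  qed
  have fin: "finite {x. \<alpha> x \<noteq> 0}" and card: "card {x. \<alpha> x \<noteq> 0} = N"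
    using assms by (auto simp: configs_N_def configs_def)
  from fin have P: "finite ?P" by simp
  show "finite (unlike_neighbours \<alpha>)"
    using sub P by (meson finite_imageI finite_subset)
  have "card (unlike_neighbours \<alpha>) \<le> card ?P"
    using surj_card_le[OF P sub] .
  then show "card (unlike_neighbours \<alpha>) \<le> 4 * N"
    unfolding card_cartesian_product card by simp
qed

text \<open>The site of an unlike pair that is occupied comes either first or second.\<close>

lemma sum_unlike_neighbours:
  assumes \<alpha>: "\<alpha> \<in> configs_N N" and sym: "\<And>x y. h (x, y) = h (y, x)"
  shows "(\<Sum>p\<in>unlike_neighbours \<alpha>. h p) = 2 * (\<Sum>p\<in>free_neighbours \<alpha>. h p :: complex)"
proof -
  let ?E = "free_neighbours \<alpha>"
  have cases: "\<alpha> x = 0 \<or> \<alpha> x = Suc 0" for x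
    using \<alpha> configs_N_subset configs_cases by blast
  have eq: "unlike_neighbours \<alpha> = ?E \<union> prod.swap ` ?E"
  proof (rule set_eqI)
    fix p
    show "p \<in> unlike_neighbours \<alpha> \<longleftrightarrow> p \<in> ?E \<union> prod.swap ` ?E"
      using cases[of "fst p"] cases[of "snd p"]
      by (cases p) (auto simp: unlike_neighbours_def free_neighbours_def abs_minus_commute)
  qed
  have fin: "finite ?E"
    using unlike_neighbours_bound(1)[OF \<alpha>] eq by auto
  have disj: "?E \<inter> prod.swap ` ?E = {}"
    by (auto simp: free_neighbours_def)
  have "(\<Sum>p\<in>prod.swap ` ?E. h p) = (\<Sum>p\<in>?E. h p)"
    by (subst sum.reindex) (use sym in \<open>auto intro!: sum.cong\<close>)
  then show ?thesis
    unfolding eq by (simp add: sum.union_disjoint fin disj)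
qed

text \<open>The squared norms of the bond terms are summable because each configuration meets at most
  \<open>4 * N\<close> bonds, so the operator sum may be evaluated pointwise. The factor \<open>-1/2\<close> is absorbed
  by the two orders of every pair and by the sign of the summand.\<close>

lemma heisenberg_eqI:
  assumes f: "f \<in> ell2_on (configs_N N)" and G: "G \<in> ell2_on (configs_N N)"
    and eq: "\<And>\<alpha>. \<alpha> \<in> configs_N N \<Longrightarrow> ell2_apply G \<alpha> =
      (\<Sum>(x, y)\<in>free_neighbours \<alpha>.
        2 * complex_of_real b * ell2_apply f \<alpha> - 2 * complex_of_real a * ell2_apply f (\<alpha> \<circ> Transposition.transpose x y))"
  shows "heisenberg a b f = G"
proof -
  let ?I = "{(x, y). \<bar>x - y\<bar> = (1::int)}"
  let ?g = "\<lambda>p. bond_term a b (fst p) (snd p) f"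
  let ?D = "\<lambda>p. {\<alpha>. \<alpha> (fst p) \<noteq> \<alpha> (snd p)}"
  have D: "{p \<in> ?I. \<alpha> \<in> ?D p} = unlike_neighbours \<alpha>" for \<alpha>
    by (auto simp: unlike_neighbours_def)
  have g: "ell2_apply (?g p) \<alpha> = (if p \<in> unlike_neighbours \<alpha>
      then 2 * complex_of_real a * ell2_apply f (\<alpha> \<circ> Transposition.transpose (fst p) (snd p)) - 2 * complex_of_real b * ell2_apply f \<alpha> else 0)"
    if "p \<in> ?I" for p \<alpha>
    using that by (subst bond_term_apply[OF f]) (auto simp: unlike_neighbours_def)
  let ?J = "\<lambda>\<alpha>. {p \<in> ?I. ell2_apply (?g p) \<alpha> \<noteq> 0}"
  have J: "?J \<alpha> \<subseteq> unlike_neighbours \<alpha>" for \<alpha>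
  proof
    fix p assume "p \<in> ?J \<alpha>"
    then show "p \<in> unlike_neighbours \<alpha>"
      using g[of p \<alpha>] by (auto split: if_splits)
  qed
  \<comment> \<open>Off the \<open>N\<close>-particle configurations there is no overlap bound, but there every bond term
    vanishes, because exchanges conserve the particle number.\<close>
  have J0: "?J \<alpha> = {}" if "\<alpha> \<notin> configs_N N" for \<alpha>
  proof -
    have "ell2_apply f \<alpha> = 0" "ell2_apply f (\<alpha> \<circ> Transposition.transpose x y) = 0" for x y
      using f that by (auto intro!: ell2_on_apply simp: configs_comp_transpose)
    then show ?thesis using g[of _ \<alpha>] by simp
  qed
  have "(?g has_sum ((-2) *\<^sub>C G)) ?I"
  proof (rule has_sum_bounded_overlap[where K = "4 * N"])
    fix \<alpha>
    show "finite (?J \<alpha>)"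
    proof (cases "\<alpha> \<in> configs_N N")
      case True
      then show ?thesis by (rule finite_subset[OF J unlike_neighbours_bound(1)])
    next
      case False
      show ?thesis unfolding J0[OF False] by simp
    qed
    show "card (?J \<alpha>) \<le> 4 * N"
    proof (cases "\<alpha> \<in> configs_N N")
      case True
      then show ?thesis
        using card_mono[OF unlike_neighbours_bound(1)[OF True] J]
          unlike_neighbours_bound(2)[OF True] by linarith
    next
      case False
      show ?thesis unfolding J0[OF False] by simp
    qed
    show "ell2_apply ((-2) *\<^sub>C G) \<alpha> = (\<Sum>p\<in>?J \<alpha>. ell2_apply (?g p) \<alpha>)"
    proof (cases "\<alpha> \<in> configs_N N")
      case True
      let ?h = "\<lambda>p. 2 * complex_of_real a * ell2_apply f (\<alpha> \<circ> Transposition.transpose (fst p) (snd p)) - 2 * complex_of_real b * ell2_apply f \<alpha>"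
      have I: "p \<in> ?I" if "p \<in> unlike_neighbours \<alpha>" for p
        using that by (auto simp: unlike_neighbours_def)
      have "(\<Sum>p\<in>?J \<alpha>. ell2_apply (?g p) \<alpha>) = (\<Sum>p\<in>unlike_neighbours \<alpha>. ell2_apply (?g p) \<alpha>)"
        by (rule sum.mono_neutral_left[OF unlike_neighbours_bound(1)[OF True] J]) (use I in blast)
      also have "\<dots> = (\<Sum>p\<in>unlike_neighbours \<alpha>. ?h p)"
        by (rule sum.cong[OF refl]) (simp only: g[OF I] if_True)
      also have "\<dots> = 2 * (\<Sum>p\<in>free_neighbours \<alpha>. ?h p)"
        by (rule sum_unlike_neighbours[OF True]) (simp add: transpose_commute)
      also have "\<dots> = -2 * ell2_apply G \<alpha>"
        unfolding eq[OF True] by (simp add: case_prod_unfold sum_negf[symmetric])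
      finally show ?thesis unfolding scaleC.rep_eq by (rule sym)
    next
      case False
      then show ?thesis
        unfolding J0[OF False] unfolding scaleC.rep_eq using G by (simp add: ell2_on_def)
    qed
  next
    let ?C = "(2 * \<bar>a\<bar> + 2 * \<bar>b\<bar>)\<^sup>2"
    show "(\<lambda>p. (norm (?g p))\<^sup>2) summable_on ?I"
    proof (rule summable_on_comparison_test)
      show "(\<lambda>p. ?C * (norm (ell2_restrict (?D p) f))\<^sup>2) summable_on ?I"
        by (intro summable_on_cmult_right summable_norm_restrict[OF f, of _ _ "4 * N"])
          (simp_all only: D unlike_neighbours_bound)
      show "(norm (?g p))\<^sup>2 \<le> ?C * (norm (ell2_restrict (?D p) f))\<^sup>2" if "p \<in> ?I" for p
        unfolding power_mult_distrib[symmetric]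
        using that by (intro power_mono norm_bond_term_le[OF f]) auto
    qed simp
  qed
  then have "(\<Sum>\<^sub>\<infinity>p\<in>?I. ?g p) = (-2) *\<^sub>C G" by (rule infsumI)
  then have "heisenberg a b f = (- 1 / 2) *\<^sub>C (-2) *\<^sub>C G"
    by (simp add: heisenberg_def bond_term_def case_prod_unfold)
  also have "\<dots> = G"
    by (simp add: cell2.scale_scale)
  finally show ?thesis .
qed

lemma heisenberg_N_eq:
  assumes f: "f \<in> ell2_on (configs_N N)" and H: "heisenberg a b f \<in> ell2_on (configs_N N)"
  shows "heisenberg_N N a b f = heisenberg a b f"
proof -
  have sub: "ell2_on (configs_N N) \<subseteq> ell2_on configs"
    by (intro ell2_on_mono configs_N_subset)
  have "inj_on varsigma tensor_space"
    by (rule inj_onI) (simp add: tensor_space_eq varsigma_eq)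
  then have "inv_into tensor_space varsigma (varsigma f) = f"
    by (rule inv_into_f_f) (use f sub in \<open>auto simp: tensor_space_eq\<close>)
  moreover have "varsigma f = f" "varsigma (heisenberg a b f) = heisenberg a b f"
    using f H sub by (auto intro: varsigma_eq)
  ultimately show ?thesis
    using f by (simp add: heisenberg_N_def)
qed

section \<open>The Toeplitz operators in coordinates\<close>

lemma v_less_apply:
  assumes "f \<in> ell2_on (ints_less N)"
  shows "ell2_apply (v_less N \<eta> f) \<xi> = (if \<xi> \<in> ints_less N then ell2_apply f (\<xi> - \<eta>) else 0)"
  using assms by (simp add: v_less_def ell2_restrict.rep_eq ell2_shift.rep_eq)

lemma v_less_in: "f \<in> ell2_on (ints_less N) \<Longrightarrow> v_less N \<eta> f \<in> ell2_on (ints_less N)"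
  by (simp add: v_less_def ell2_restrict_in)

lemma cinner_v_less:
  assumes f: "f \<in> ell2_on (ints_less N)" and g: "g \<in> ell2_on (ints_less N)"
  shows "cinner (v_less N \<eta> f) g = cinner f (v_less N (- \<eta>) g)"
proof -
  have bij: "bij_betw (\<lambda>\<xi>. \<xi> + \<eta>) UNIV UNIV"
    by (rule bij_betw_byWitness[of _ "\<lambda>\<xi>. \<xi> - \<eta>"]) auto
  have "cinner (v_less N \<eta> f) g = (\<Sum>\<^sub>\<infinity>\<xi>. cnj (ell2_apply f (\<xi> - \<eta>)) * ell2_apply g \<xi>)"
    unfolding cinner.rep_eq v_less_apply[OF f]
    by (rule infsum_cong) (use g in \<open>auto simp: ell2_on_def\<close>)
  also have "\<dots> = (\<Sum>\<^sub>\<infinity>\<xi>. cnj (ell2_apply f \<xi>) * ell2_apply g (\<xi> + \<eta>))"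
    using infsum_reindex_bij_betw[OF bij, of "\<lambda>\<xi>. cnj (ell2_apply f (\<xi> - \<eta>)) * ell2_apply g \<xi>"]
    by simp
  also have "\<dots> = cinner f (v_less N (- \<eta>) g)"
    unfolding cinner.rep_eq v_less_apply[OF g]
    by (rule infsum_cong) (use f in \<open>auto simp: ell2_on_def\<close>)
  finally show ?thesis .
qed

text \<open>The truncated shift by \<open>- \<eta>\<close> is an adjoint, and testing against unit vectors shows that any
  other adjoint agrees with it.\<close>

lemma adjoint_v_less:
  assumes g: "g \<in> ell2_on (ints_less N)"
  shows "adjoint_on (ell2_on (ints_less N)) (v_less N \<eta>) g = v_less N (- \<eta>) g"
proof -
  define Z where "Z = ints_less N"
  define B where "B = adjoint_on (ell2_on Z) (v_less N \<eta>)"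
  have B: "B \<in> ell2_on Z \<rightarrow> ell2_on Z \<and>
      (\<forall>f\<in>ell2_on Z. \<forall>g\<in>ell2_on Z. cinner (v_less N \<eta> f) g = cinner f (B g))"
    unfolding B_def adjoint_on_def
    by (rule someI[of _ "v_less N (- \<eta>)"]) (auto simp: Z_def v_less_in cinner_v_less)
  have Bg: "B g \<in> ell2_on Z" using B g by (auto simp: Z_def)
  have "ell2_apply (B g) \<xi> = ell2_apply (v_less N (- \<eta>) g) \<xi>" for \<xi>
  proof (cases "\<xi> \<in> Z")
    case True
    then have u: "ell2_unit \<xi> \<in> ell2_on Z" by (rule ell2_unit_in)
    have "cinner (ell2_unit \<xi>) (B g) = cinner (v_less N \<eta> (ell2_unit \<xi>)) g"
      using B u g by (simp add: Z_def)
    also have "\<dots> = cinner (ell2_unit \<xi>) (v_less N (- \<eta>) g)"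
      using u g unfolding Z_def by (rule cinner_v_less)
    finally show ?thesis by (simp add: cinner_unit_left)
  next
    case False
    then show ?thesis using Bg v_less_in[OF g] by (simp add: ell2_on_def Z_def)
  qed
  then show ?thesis by (simp add: ell2_eqI B_def Z_def)
qed

text \<open>Shifting back to \<open>\<xi> - \<eta>\<close> and forth again recovers the value at \<open>\<xi>\<close>, unless it was cut off
  at \<open>\<xi> - \<eta>\<close> in between.\<close>

lemma q_less_apply:
  assumes f: "f \<in> ell2_on (ints_less N)"
  shows "ell2_apply (q_less N \<eta> f) \<xi> =
    (if \<xi> \<in> ints_less N \<and> \<xi> - \<eta> \<in> ints_less N then ell2_apply f \<xi> else 0)"
  by (simp add: q_less_def adjoint_v_less[OF f] v_less_apply[OF v_less_in[OF f]] v_less_apply[OF f])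

lemma q_less_in: "f \<in> ell2_on (ints_less N) \<Longrightarrow> q_less N \<eta> f \<in> ell2_on (ints_less N)"
  by (simp add: ell2_on_def q_less_apply)

lemma finite_steps: "finite (steps N)"
  by (auto simp: steps_def)

lemma infsum_steps:
  fixes w :: "(nat \<Rightarrow> int) \<Rightarrow> 'a ell2"
  shows "(\<Sum>\<^sub>\<infinity>\<eta>\<in>ints_N N. (c * indicator (steps N) \<eta>) *\<^sub>C w \<eta>) = (\<Sum>\<eta>\<in>steps N. c *\<^sub>C w \<eta>)"
proof -
  have "steps N \<subseteq> ints_N N"
    by (auto simp: steps_def ints_N_def unit_step_def)
  then have "(\<Sum>\<^sub>\<infinity>\<eta>\<in>ints_N N. (c * indicator (steps N) \<eta>) *\<^sub>C w \<eta>) = (\<Sum>\<^sub>\<infinity>\<eta>\<in>steps N. c *\<^sub>C w \<eta>)"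
    by (intro infsum_cong_neutral) (auto simp: indicator_def)
  then show ?thesis by (simp add: finite_steps)
qed

lemma toeplitz_steps:
  assumes f: "f \<in> ell2_on (ints_less N)"
    and \<phi>: "\<phi> = (\<lambda>\<eta>. c * indicator (steps N) \<eta>)" and \<psi>: "\<psi> = (\<lambda>\<eta>. d * indicator (steps N) \<eta>)"
  shows "T_less N \<phi> f + V_less N \<psi> f \<in> ell2_on (ints_less N)"
    and "\<xi> \<in> ints_less N \<Longrightarrow> ell2_apply (T_less N \<phi> f + V_less N \<psi> f) \<xi> =
      (\<Sum>\<eta> | \<eta> \<in> steps N \<and> \<xi> - \<eta> \<in> ints_less N. c * ell2_apply f (\<xi> - \<eta>) + d * ell2_apply f \<xi>)"
proof -
  have TV: "T_less N \<phi> f + V_less N \<psi> f =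
      (\<Sum>\<eta>\<in>steps N. c *\<^sub>C v_less N \<eta> f) + (\<Sum>\<eta>\<in>steps N. d *\<^sub>C q_less N \<eta> f)"
    unfolding T_less_def V_less_def \<phi> \<psi> infsum_steps ..
  show "T_less N \<phi> f + V_less N \<psi> f \<in> ell2_on (ints_less N)"
    unfolding TV by (intro ell2_on_add ell2_on_sum ell2_on_scaleC v_less_in q_less_in f)
  assume \<xi>: "\<xi> \<in> ints_less N"
  have "ell2_apply (T_less N \<phi> f + V_less N \<psi> f) \<xi> =
      (\<Sum>\<eta>\<in>steps N. c * ell2_apply (v_less N \<eta> f) \<xi> + d * ell2_apply (q_less N \<eta> f) \<xi>)"
    unfolding TV by (simp add: plus_ell2.rep_eq ell2_apply_sum scaleC.rep_eq sum.distrib)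
  also have "\<dots> = (\<Sum>\<eta> | \<eta> \<in> steps N \<and> \<xi> - \<eta> \<in> ints_less N.
      c * ell2_apply f (\<xi> - \<eta>) + d * ell2_apply f \<xi>)"
    by (rule sum.mono_neutral_cong_right[OF finite_steps])
      (use f \<xi> in \<open>auto simp: v_less_apply q_less_apply ell2_on_def\<close>)
  finally show "ell2_apply (T_less N \<phi> f + V_less N \<psi> f) \<xi> = \<dots>" .
qed

section \<open>Configurations as ordered particle positions\<close>

lemma ints_less_mono:
  assumes "\<xi> \<in> ints_less N" "i \<in> {1..N}" "j \<in> {1..N}" "i < j"
  shows "\<xi> i < \<xi> j"
proof -
  have "strict_mono_on {1..N} \<xi>" using assms(1) by (simp add: ints_less_def)
  then show ?thesis using assms(2-4) by (rule strict_mono_onD)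
qed

lemma ints_less_inj: "\<xi> \<in> ints_less N \<Longrightarrow> inj_on \<xi> {1..N}"
proof (rule linorder_inj_onI)
  fix i j assume "\<xi> \<in> ints_less N" "i \<in> {1..N}" "j \<in> {1..N}" "i < j"
  then have "\<xi> i < \<xi> j" by (rule ints_less_mono)
  then show "\<xi> i \<noteq> \<xi> j" by simp
qed auto

definition occupation :: "nat \<Rightarrow> (nat \<Rightarrow> int) \<Rightarrow> int \<Rightarrow> nat"
  where "occupation N \<xi> = indicator (\<xi> ` {1..N})"

lemma occupation_eq_0 [simp]: "occupation N \<xi> x = 0 \<longleftrightarrow> x \<notin> \<xi> ` {1..N}"
  by (simp add: occupation_def indicator_def)

text \<open>A strictly increasing tuple is the sorted enumeration of its set of entries, and a finite set
  has exactly one such enumeration.\<close>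

lemma bij_betw_occupation: "bij_betw (occupation N) (ints_less N) (configs_N N)"
  unfolding bij_betw_def
proof
  have img: "\<xi> ` {1..N} = set (map \<xi> [1..<Suc N])" for \<xi> :: "nat \<Rightarrow> int"
    by (auto simp: atLeastLessThanSuc_atLeastAtMost)
  have sorted: "sorted_wrt (<) (map \<xi> [1..<Suc N])" if "\<xi> \<in> ints_less N" for \<xi>
    unfolding sorted_wrt_map
  proof (rule sorted_wrt_mono_rel[OF _ sorted_wrt_upt])
    fix i j assume "i \<in> set [1..<Suc N]" "j \<in> set [1..<Suc N]" "i < j"
    then show "\<xi> i < \<xi> j" by (intro ints_less_mono[OF that]) auto
  qed
  show "inj_on (occupation N) (ints_less N)"
  proof (rule inj_onI)
    fix \<xi> \<zeta> assume \<xi>: "\<xi> \<in> ints_less N" and \<zeta>: "\<zeta> \<in> ints_less N"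
      and eq: "occupation N \<xi> = occupation N \<zeta>"
    have "\<xi> ` {1..N} = \<zeta> ` {1..N}"
      using eq occupation_eq_0 by (metis subsetI subset_antisym)
    then have "map \<xi> [1..<Suc N] = map \<zeta> [1..<Suc N]"
      unfolding img by (rule strict_sorted_equal[OF sorted[OF \<zeta>] sorted[OF \<xi>]])
    then have "\<xi> i = \<zeta> i" if "i \<in> {1..N}" for i
      using that by (simp add: map_eq_conv del: upt_Suc)
    moreover have "\<xi> i = \<zeta> i" if "i \<notin> {1..N}" for i
      using that \<xi> \<zeta> by (simp add: ints_less_def ints_N_def)
    ultimately show "\<xi> = \<zeta>" by blast
  qed
  show "occupation N ` ints_less N = configs_N N"
  proof safe
    fix \<xi> assume "\<xi> \<in> ints_less N"
    then have "inj_on \<xi> {1..N}" by (rule ints_less_inj)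
    then have "card (\<xi> ` {1..N}) = N" by (simp add: card_image)
    then show "occupation N \<xi> \<in> configs_N N"
      by (simp add: configs_N_def configs_def) (auto simp: occupation_def indicator_def)
  next
    fix \<alpha> assume \<alpha>: "\<alpha> \<in> configs_N N"
    define A where "A = {x. \<alpha> x \<noteq> 0}"
    define xs where "xs = sorted_list_of_set A"
    have A: "finite A" "card A = N" using \<alpha> by (auto simp: A_def configs_N_def configs_def)
    have xs: "set xs = A" "length xs = N" "sorted_wrt (<) xs"
      using A by (simp_all add: xs_def)
    define \<xi> where "\<xi> i = (if i \<in> {1..N} then xs ! (i - 1) else 0)" for i
    have "strict_mono_on {1..N} \<xi>"
      by (rule strict_mono_onI)
        (use xs in \<open>auto simp: \<xi>_def intro!: sorted_wrt_nth_less[of "(<)"]\<close>)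
    then have \<xi>: "\<xi> \<in> ints_less N" by (simp add: ints_less_def ints_N_def \<xi>_def)
    have "\<xi> ` {1..N} = (\<lambda>i. xs ! i) ` (\<lambda>i. i - 1) ` {1..N}"
      by (simp add: \<xi>_def image_image)
    also have "(\<lambda>i. i - 1) ` {1..N} = {..<N}"
    proof
      show "{..<N} \<subseteq> (\<lambda>i. i - 1) ` {1..N}"
      proof
        fix i assume "i \<in> {..<N}"
        then show "i \<in> (\<lambda>i. i - 1) ` {1..N}" by (intro image_eqI[of _ _ "Suc i"]) auto
      qed
    qed auto
    also have "(\<lambda>i. xs ! i) ` {..<N} = A"
      using xs by (auto simp: set_conv_nth)
    finally have img: "\<xi> ` {1..N} = A" .
    have "\<alpha> x = occupation N \<xi> x" for x
    proof -
      have "\<alpha> x = 0 \<or> \<alpha> x = Suc 0" using \<alpha> configs_N_subset configs_cases by blast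
      then show ?thesis unfolding occupation_def img by (auto simp: A_def)
    qed
    then have "\<alpha> = occupation N \<xi>" by blast
    then show "\<alpha> \<in> occupation N ` ints_less N" using \<xi> by blast
  qed
qed

text \<open>Encoding a step by the moving particle and its direction avoids recovering the moving index
  from the function \<open>\<eta>\<close>.\<close>

definition single_step :: "nat \<times> int \<Rightarrow> nat \<Rightarrow> int"
  where "single_step = (\<lambda>(i, \<epsilon>) j. if j = i then \<epsilon> else 0)"

lemma steps_eq: "steps N = single_step ` ({1..N} \<times> {1, - 1})"
proof -
  have "single_step (i, 1) = unit_step i" "single_step (i, - 1) = - unit_step i" for i
    by (auto simp: single_step_def unit_step_def fun_eq_iff)
  then have "single_step ` ({i} \<times> {1, - 1}) = {unit_step i, - unit_step i}" for i
    by (simp add: insert_Times_insert)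
  moreover have "{1..N} \<times> {1, - 1 :: int} = (\<Union>i\<in>{1..N}. {i} \<times> {1, - 1})" by blast
  ultimately show ?thesis
    unfolding steps_def by (simp only: image_UN)
qed

text \<open>Positions are integers, so a move by one site cannot jump over another particle: order can only
  be lost by landing on an occupied site.\<close>

lemma minus_single_step_in:
  assumes \<xi>: "\<xi> \<in> ints_less N" and i: "i \<in> {1..N}" and \<epsilon>: "\<epsilon> \<in> {1, - 1}"
  shows "\<xi> - single_step (i, \<epsilon>) \<in> ints_less N \<longleftrightarrow> \<xi> i - \<epsilon> \<notin> \<xi> ` {1..N}"
proof
  let ?\<xi> = "\<xi> - single_step (i, \<epsilon>)"
  have val: "?\<xi> j = (if j = i then \<xi> i - \<epsilon> else \<xi> j)" for j
    by (simp add: single_step_def)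
  have mono: "\<xi> j < \<xi> k" if "j \<in> {1..N}" "k \<in> {1..N}" "j < k" for j k
    using \<xi> that by (rule ints_less_mono)
  {
    assume "?\<xi> \<in> ints_less N"
    then have inj: "inj_on ?\<xi> {1..N}" by (rule ints_less_inj)
    show "\<xi> i - \<epsilon> \<notin> \<xi> ` {1..N}"
    proof
      assume "\<xi> i - \<epsilon> \<in> \<xi> ` {1..N}"
      then obtain j where j: "j \<in> {1..N}" "\<xi> i - \<epsilon> = \<xi> j" by blast
      then have "j \<noteq> i" using \<epsilon> by auto
      then have "?\<xi> i = ?\<xi> j" unfolding val using j by simp
      then have "i = j" by (rule inj_onD[OF inj _ i j(1)])
      with \<open>j \<noteq> i\<close> show False by simp
    qed
  next
    assume free: "\<xi> i - \<epsilon> \<notin> \<xi> ` {1..N}"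
    have "strict_mono_on {1..N} ?\<xi>"
    proof (rule strict_mono_onI)
      fix j k assume jk: "j \<in> {1..N}" "k \<in> {1..N}" "j < k"
      have "\<xi> i - \<epsilon> \<noteq> \<xi> j" "\<xi> i - \<epsilon> \<noteq> \<xi> k" using free jk by auto
      then show "?\<xi> j < ?\<xi> k" unfolding val using mono[OF jk] jk(3) \<epsilon> by auto
    qed
    moreover have "?\<xi> \<in> ints_N N"
      using \<xi> i by (auto simp: ints_less_def ints_N_def single_step_def)
    ultimately show "?\<xi> \<in> ints_less N" by (simp add: ints_less_def)
  }
qed

lemma occupation_minus_single_step:
  assumes \<xi>: "\<xi> \<in> ints_less N" and i: "i \<in> {1..N}" and free: "\<xi> i - \<epsilon> \<notin> \<xi> ` {1..N}"
  shows "occupation N (\<xi> - single_step (i, \<epsilon>)) =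
    occupation N \<xi> \<circ> Transposition.transpose (\<xi> i) (\<xi> i - \<epsilon>)"
proof -
  let ?\<xi> = "\<xi> - single_step (i, \<epsilon>)"
  have inj: "inj_on \<xi> {1..N}" using \<xi> by (rule ints_less_inj)
  have val: "?\<xi> j = (if j = i then \<xi> i - \<epsilon> else \<xi> j)" for j
    by (simp add: single_step_def)
  have "?\<xi> ` {1..N} = ?\<xi> ` insert i ({1..N} - {i})"
    using i by (simp add: insert_absorb)
  also have "\<dots> = insert (\<xi> i - \<epsilon>) (\<xi> ` ({1..N} - {i}))"
    unfolding image_insert val by (auto simp: image_iff val)
  also have "\<dots> = insert (\<xi> i - \<epsilon>) (\<xi> ` {1..N} - {\<xi> i})"
    using inj i by (auto dest: inj_onD)
  finally have img: "?\<xi> ` {1..N} = insert (\<xi> i - \<epsilon>) (\<xi> ` {1..N} - {\<xi> i})" .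
  have occ: "\<xi> i \<in> \<xi> ` {1..N}" using i by blast
  show ?thesis
  proof
    fix x
    consider "x = \<xi> i" | "x = \<xi> i - \<epsilon>" | "x \<noteq> \<xi> i" "x \<noteq> \<xi> i - \<epsilon>" by blast
    then show "occupation N ?\<xi> x =
        (occupation N \<xi> \<circ> Transposition.transpose (\<xi> i) (\<xi> i - \<epsilon>)) x"
      by cases (use occ free in \<open>simp_all only: occupation_def img, auto simp: indicator_def\<close>)
  qed
qed

text \<open>Both index sets are parametrised by the pairs \<open>(i, \<epsilon>)\<close> for which the site \<open>\<xi> i - \<epsilon>\<close> is free.
  A step with value \<open>\<epsilon>\<close> at \<open>i\<close> shifts the argument by \<open>- \<epsilon>\<close>, hence the pair of sites
  \<open>(\<xi> i, \<xi> i - \<epsilon>)\<close>.\<close>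

lemma sum_allowed_steps:
  fixes h :: "(int \<Rightarrow> nat) \<Rightarrow> 'a::comm_monoid_add"
  assumes \<xi>: "\<xi> \<in> ints_less N"
  shows "(\<Sum>\<eta> | \<eta> \<in> steps N \<and> \<xi> - \<eta> \<in> ints_less N. h (occupation N (\<xi> - \<eta>))) =
    (\<Sum>(x, y)\<in>free_neighbours (occupation N \<xi>). h (occupation N \<xi> \<circ> Transposition.transpose x y))"
proof -
  define P where "P = {(i, \<epsilon>). i \<in> {1..N} \<and> \<epsilon> \<in> {1, - 1} \<and> \<xi> i - \<epsilon> \<notin> \<xi> ` {1..N}}"
  have inj: "inj_on \<xi> {1..N}" using \<xi> by (rule ints_less_inj)
  have bij1: "bij_betw single_step P {\<eta>. \<eta> \<in> steps N \<and> \<xi> - \<eta> \<in> ints_less N}"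
    unfolding bij_betw_def
  proof
    show "inj_on single_step P"
    proof (rule inj_onI)
      fix p q assume pq: "p \<in> P" "q \<in> P" "single_step p = single_step q"
      obtain i \<epsilon> j \<delta> where p: "p = (i, \<epsilon>)" and q: "q = (j, \<delta>)" by (cases p, cases q)
      have "single_step p i = single_step q i" "single_step p j = single_step q j"
        using pq by simp_all
      then show "p = q"
        using pq unfolding p q by (auto simp: single_step_def P_def split: if_splits)
    qed
    show "single_step ` P = {\<eta>. \<eta> \<in> steps N \<and> \<xi> - \<eta> \<in> ints_less N}"
      unfolding steps_eq P_def using minus_single_step_in[OF \<xi>] by auto
  qed
  have bij2: "bij_betw (\<lambda>(i, \<epsilon>). (\<xi> i, \<xi> i - \<epsilon>)) P (free_neighbours (occupation N \<xi>))"
    unfolding bij_betw_def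
  proof
    show "inj_on (\<lambda>(i, \<epsilon>). (\<xi> i, \<xi> i - \<epsilon>)) P"
    proof (rule inj_onI, clarify)
      fix i \<epsilon> j \<delta> assume "(i, \<epsilon>) \<in> P" "(j, \<delta>) \<in> P" and eq: "\<xi> i = \<xi> j" "\<xi> i - \<epsilon> = \<xi> j - \<delta>"
      then have "i \<in> {1..N}" "j \<in> {1..N}" unfolding P_def by blast+
      then show "i = j \<and> \<epsilon> = \<delta>" using eq inj_onD[OF inj eq(1)] by simp
    qed
    show "(\<lambda>(i, \<epsilon>). (\<xi> i, \<xi> i - \<epsilon>)) ` P = free_neighbours (occupation N \<xi>)"
    proof (intro subset_antisym subsetI)
      fix p assume "p \<in> free_neighbours (occupation N \<xi>)"
      then obtain x y where p: "p = (x, y)" "\<bar>x - y\<bar> = 1" "x \<in> \<xi> ` {1..N}" "y \<notin> \<xi> ` {1..N}"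
        by (auto simp: free_neighbours_def)
      then obtain i where "i \<in> {1..N}" "x = \<xi> i" by blast
      then show "p \<in> (\<lambda>(i, \<epsilon>). (\<xi> i, \<xi> i - \<epsilon>)) ` P"
        using p by (intro image_eqI[of _ _ "(i, x - y)"]) (auto simp: P_def)
    qed (auto simp: P_def free_neighbours_def)
  qed
  have "(\<Sum>\<eta> | \<eta> \<in> steps N \<and> \<xi> - \<eta> \<in> ints_less N. h (occupation N (\<xi> - \<eta>))) =
      (\<Sum>p\<in>P. h (occupation N (\<xi> - single_step p)))"
    by (rule sum.reindex_bij_betw[OF bij1, symmetric])
  also have "\<dots> = (\<Sum>p\<in>P. case (case p of (i, \<epsilon>) \<Rightarrow> (\<xi> i, \<xi> i - \<epsilon>)) of
      (x, y) \<Rightarrow> h (occupation N \<xi> \<circ> Transposition.transpose x y))"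
  proof (rule sum.cong[OF refl])
    fix p assume "p \<in> P"
    then obtain i \<epsilon> where p: "p = (i, \<epsilon>)" and i: "i \<in> {1..N}" and free: "\<xi> i - \<epsilon> \<notin> \<xi> ` {1..N}"
      unfolding P_def by blast
    show "h (occupation N (\<xi> - single_step p)) =
        (case (case p of (i, \<epsilon>) \<Rightarrow> (\<xi> i, \<xi> i - \<epsilon>)) of
          (x, y) \<Rightarrow> h (occupation N \<xi> \<circ> Transposition.transpose x y))"
      by (simp only: p prod.case occupation_minus_single_step[OF \<xi> i free])
  qed
  also have "\<dots> = (\<Sum>(x, y)\<in>free_neighbours (occupation N \<xi>).
      h (occupation N \<xi> \<circ> Transposition.transpose x y))"
    by (rule sum.reindex_bij_betw[OF bij2])
  finally show ?thesis .
qed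

section \<open>Unitary equivalence\<close>

theorem proposition2p2:
  fixes N :: nat and a b :: real and \<phi> \<psi> :: "(nat \<Rightarrow> int) \<Rightarrow> complex"
  assumes "N \<ge> 1"
    and "\<phi> = (\<lambda>\<eta>. - 2 * complex_of_real a * indicator (steps N) \<eta>)"
    and "\<psi> = (\<lambda>\<eta>. 2 * complex_of_real b * indicator (steps N) \<eta>)"
  shows "unitarily_equivalent
    (ell2_on (configs_N N)) (heisenberg_N N a b)
    (ell2_on (ints_less N)) (\<lambda>f. T_less N \<phi> f + V_less N \<psi> f)"
proof -
  let ?H = "ell2_on (configs_N N)" and ?K = "ell2_on (ints_less N)"
  let ?B = "\<lambda>f. T_less N \<phi> f + V_less N \<psi> f"
  let ?occ = "occupation N"
  let ?pos = "inv_into (ints_less N) ?occ"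
  define U where "U = ell2_pullback (ints_less N) ?occ"
  define W where "W = ell2_pullback (configs_N N) ?pos"
  note occ = bij_betw_occupation[of N]
  note pos = bij_betw_inv_into[OF occ]
  note B = toeplitz_steps[OF _ assms(2,3)]
  have U: "unitary_on ?H ?K U"
    unfolding U_def by (rule unitary_on_ell2_pullback[OF occ])
  have U_in: "U f \<in> ?K" for f by (simp add: U_def ell2_pullback_in)
  have U_apply: "ell2_apply (U f) \<xi> = ell2_apply f (?occ \<xi>)" if "\<xi> \<in> ints_less N" for f \<xi>
    using that bij_betw_imp_inj_on[OF occ] by (simp add: U_def ell2_pullback.rep_eq)
  have W_in: "W g \<in> ?H" for g by (simp add: W_def ell2_pullback_in)
  have UW: "U (W g) = g" if "g \<in> ?K" for g
    unfolding U_def W_def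
    by (rule ell2_pullback_inverse[OF occ _ that]) (rule bij_betw_inv_into_left[OF occ])
  \<comment> \<open>As the Hamiltonian is an infinite sum, the limit is exhibited first: it is the Toeplitz operator
    carried back to configurations, which is known to be square summable.\<close>
  have heis: "heisenberg a b f = W (?B (U f))" if f: "f \<in> ?H" for f
  proof (rule heisenberg_eqI[OF f W_in])
    fix \<alpha> assume \<alpha>: "\<alpha> \<in> configs_N N"
    define \<xi> where "\<xi> = ?pos \<alpha>"
    have \<xi>: "\<xi> \<in> ints_less N" "?occ \<xi> = \<alpha>"
      using bij_betwE[OF pos] \<alpha> bij_betw_inv_into_right[OF occ \<alpha>] by (auto simp: \<xi>_def)
    have "ell2_apply (W (?B (U f))) \<alpha> = ell2_apply (?B (U f)) \<xi>"
      using \<alpha> bij_betw_imp_inj_on[OF pos] by (simp add: W_def ell2_pullback.rep_eq \<xi>_def)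
    also have "\<dots> = (\<Sum>\<eta> | \<eta> \<in> steps N \<and> \<xi> - \<eta> \<in> ints_less N.
        - 2 * complex_of_real a * ell2_apply f (?occ (\<xi> - \<eta>)) + 2 * complex_of_real b * ell2_apply f \<alpha>)"
      unfolding B(2)[OF U_in \<xi>(1)] by (rule sum.cong) (auto simp: U_apply \<xi>)
    also have "\<dots> = (\<Sum>(x, y)\<in>free_neighbours \<alpha>.
        - 2 * complex_of_real a * ell2_apply f (\<alpha> \<circ> Transposition.transpose x y) +
        2 * complex_of_real b * ell2_apply f \<alpha>)"
      using sum_allowed_steps[OF \<xi>(1), of "\<lambda>\<beta>. - 2 * complex_of_real a * ell2_apply f \<beta> +
        2 * complex_of_real b * ell2_apply f \<alpha>"] by (simp only: \<xi>(2))
    finally show "ell2_apply (W (?B (U f))) \<alpha> = (\<Sum>(x, y)\<in>free_neighbours \<alpha>.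
        2 * complex_of_real b * ell2_apply f \<alpha> - 2 * complex_of_real a * ell2_apply f (\<alpha> \<circ> Transposition.transpose x y))"
      by (simp add: case_prod_unfold)
  qed
  then have HN: "heisenberg_N N a b f = W (?B (U f))" if "f \<in> ?H" for f
    using that by (simp add: heisenberg_N_eq W_in)
  show ?thesis
    unfolding unitarily_equivalent_def
  proof (intro conjI exI[of _ U] ballI)
    show "heisenberg_N N a b \<in> ?H \<rightarrow> ?H" by (simp add: HN W_in)
    show "?B \<in> ?K \<rightarrow> ?K" using B(1) by blast
    show "unitary_on ?H ?K U" by (rule U)
    show "U (heisenberg_N N a b f) = ?B (U f)" if "f \<in> ?H" for f
      using that by (simp add: HN UW B(1) U_in)
  qed
qed

end
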